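(* The group $(E_{6,\mathbb C})^C=\{\alpha\in \mathrm{Iso}_C(\mathfrak J(3,\mathbb C^C)) \mid \det(\alpha X)=\det X \text{ for all } X\}$ is isomorphic to the semi-direct product of the groups $(SL(3,C)\times SL(3,C))/\mathbb Z_3$ and $\mathbb Z_2$, where $\mathbb Z_3=\{(E,E),(\omega E,\omega E),(\omega^2E,\omega^2E)\}$ with $\omega\in C$, $\omega^3=1$, $\omega\neq1$, and $\mathbb Z_2=\{1,\varepsilon\}$: $$(E_{6,\mathbb C})^C\cong (SL(3,C)\times SL(3,C))/\mathbb Z_3\rtimes\mathbb Z_2 .$$ Here $SL(3,C)$ is identified with $SU(3,\mathbb C^C)$, and $\varepsilon$ acts on $SU(3,\mathbb C^C)\times SU(3,\mathbb C^C)$ by $\varepsilon(A,B)=(\overline B,\overline A)$ (this descends to the quotient by $\mathbb Z_3$).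
   Context: Two copies of the complex numbers are used: $\mathbb C=\mathbb R\oplus\mathbb R\mathbf i$ (with conjugation $x\mapsto\overline x$) and $C=\mathbb R\oplus\mathbb R i$ (the field used for complexification). $\mathbb C^C=\mathbb C\otimes_{\mathbb R}C$, with the conjugation of $\mathbb C$ extended $C$-linearly, $\overline{\,\cdot\,}:\mathbb C^C\to\mathbb C^C$. For a matrix $A$ over $\mathbb C^C$, $\overline A$ is entrywise conjugation and $A^*={}^t\overline A$. $\mathfrak J(3,\mathbb C^C)=\{X\in M(3,\mathbb C^C)\mid X^*=X\}$, a $C$-vector space whose elements are $X=\begin{pmatrix}\xi_1&x_3&\overline x_2\\ \overline x_3&\xi_2&x_1\\ x_2&\overline x_1&\xi_3\end{pmatrix}$, $\xi_i\in C$, $x_i\in\mathbb C^C$, and $\det X=\xi_1\xi_2\xi_3+x_1x_2x_3+\overline{x_1x_2x_3}-\xi_1x_1\overline x_1-\xi_2x_2\overline x_2-\xi_3x_3\overline x_3\in C$. $\mathrm{Iso}_C(V)$ is the group of $C$-linear automorphisms of $V$. $SU(3,\mathbb C^C)=\{A\in M(3,\mathbb C^C)\mid A^*A=E,\ \det A=1\}$, with $E$ the identity matrix; it is identified with $SL(3,C)$ via the isomorphism $SL(3,C)\to SU(3,\mathbb C^C)$, $A\mapsto \iota A+\overline\iota\,{}^tA^{-1}$, $\iota=\frac12(1+i\mathbf i)$. *)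

theory Defs
  imports "HOL-Analysis.Analysis" "HOL-Algebra.Coset" "HOL-Algebra.Bij"
begin

section \<open>The complexification of the complex numbers\<close>

text \<open>
  Two copies of the complex numbers occur: the field of scalars \<open>C\<close> with imaginary unit \<open>i\<close>, which
  is the type \<^typ>\<open>complex\<close>, and the real algebra \<open>\<real> \<oplus> \<real> j\<close> which is being complexified (we write
  \<open>j\<close> for its imaginary unit).  Since \<open>1, j\<close> is a real basis of the latter, every element of
  \<open>(\<real> \<oplus> \<real> j) \<otimes> C\<close> (tensor product over the reals) is \<open>1 \<otimes> a + j \<otimes> b\<close> for unique
  \<open>a, b :: complex\<close>; it is represented by \<open>CC a b\<close>.
\<close>

type_synonym 'a mat3 = "'a ^ 3 ^ 3"

datatype cplx_C = CC (fst_C: complex) (snd_C: complex)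

instantiation cplx_C :: comm_ring_1
begin

definition zero_cplx_C :: cplx_C where "0 = CC 0 0"
definition one_cplx_C :: cplx_C where "1 = CC 1 0"
definition plus_cplx_C :: "cplx_C \<Rightarrow> cplx_C \<Rightarrow> cplx_C"
  where "x + y = CC (fst_C x + fst_C y) (snd_C x + snd_C y)"
definition uminus_cplx_C :: "cplx_C \<Rightarrow> cplx_C"
  where "- x = CC (- fst_C x) (- snd_C x)"
definition minus_cplx_C :: "cplx_C \<Rightarrow> cplx_C \<Rightarrow> cplx_C"
  where "x - y = CC (fst_C x - fst_C y) (snd_C x - snd_C y)"
definition times_cplx_C :: "cplx_C \<Rightarrow> cplx_C \<Rightarrow> cplx_C"
  where "x * y = CC (fst_C x * fst_C y - snd_C x * snd_C y)
                    (fst_C x * snd_C y + snd_C x * fst_C y)"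

instance
  by standard
    (auto simp: zero_cplx_C_def one_cplx_C_def plus_cplx_C_def uminus_cplx_C_def
      minus_cplx_C_def times_cplx_C_def algebra_simps)

end

definition tensor_C :: "complex \<Rightarrow> complex \<Rightarrow> cplx_C"
  where "tensor_C z c = CC (of_real (Re z) * c) (of_real (Im z) * c)"

definition of_C :: "complex \<Rightarrow> cplx_C"
  where "of_C c = CC c 0"

text \<open>Conjugation of \<open>\<real> \<oplus> \<real> j\<close>, extended linearly over \<open>C\<close>: it does not conjugate the coefficients.\<close>

definition conj_C :: "cplx_C \<Rightarrow> cplx_C"
  where "conj_C x = CC (fst_C x) (- snd_C x)"

lemmas cplx_C_defs = zero_cplx_C_def one_cplx_C_def plus_cplx_C_def uminus_cplx_C_def
  minus_cplx_C_def times_cplx_C_def tensor_C_def of_C_def conj_C_def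

lemma tensor_C_mult: "tensor_C z c * tensor_C w d = tensor_C (z * w) (c * d)"
  by (simp add: cplx_C_defs algebra_simps)

lemma tensor_C_add:
  "tensor_C (z + w) c = tensor_C z c + tensor_C w c"
  "tensor_C z (c + d) = tensor_C z c + tensor_C z d"
  by (simp_all add: cplx_C_defs algebra_simps)

lemma tensor_C_scaleR: "tensor_C (r *\<^sub>R z) c = tensor_C z (r *\<^sub>R c)"
  by (simp add: cplx_C_defs scaleR_conv_of_real)

lemma tensor_C_one: "tensor_C 1 c = of_C c"
  by (simp add: cplx_C_defs)

lemma CC_eq_tensor_C: "CC a b = tensor_C 1 a + tensor_C \<i> b"
  by (simp add: cplx_C_defs)

lemma conj_C_tensor_C: "conj_C (tensor_C z c) = tensor_C (cnj z) c"
  by (simp add: cplx_C_defs)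

lemma conj_C_of_C_mult: "conj_C (of_C c * x) = of_C c * conj_C x"
  by (simp add: cplx_C_defs)

lemma conj_C_simps [simp]:
  "conj_C (x + y) = conj_C x + conj_C y"
  "conj_C (x * y) = conj_C x * conj_C y"
  "conj_C (x - y) = conj_C x - conj_C y"
  "conj_C (conj_C x) = x"
  "conj_C 0 = 0" "conj_C 1 = 1"
  by (simp_all add: cplx_C_defs)

lemma conj_C_fixed_iff: "conj_C x = x \<longleftrightarrow> x \<in> range of_C"
proof (cases x)
  case (CC a b)
  have "- b = b \<longleftrightarrow> b = 0" by (auto simp: complex_eq_iff)
  then show ?thesis by (auto simp: CC cplx_C_defs image_iff)
qed


section \<open>The Jordan algebra and its determinant\<close>

definition adj_C :: "cplx_C ^ 'n ^ 'm \<Rightarrow> cplx_C ^ 'm ^ 'n"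
  where "adj_C A = transpose (map_matrix conj_C A)"

definition J3 :: "cplx_C mat3 set"
  where "J3 = {X. adj_C X = X}"

definition scale_C :: "complex \<Rightarrow> cplx_C ^ 'n ^ 'm \<Rightarrow> cplx_C ^ 'n ^ 'm"
  where "scale_C c X = map_matrix (\<lambda>x. of_C c * x) X"

text \<open>
  The determinant is defined by its explicit formula; as the coefficients \<open>\<xi>\<^sub>i\<close> it is a member of \<open>C\<close>
  regarded as a subset of \<^typ>\<open>cplx_C\<close>, see \<open>J3_det_in_C\<close>.
\<close>

definition J3_det :: "cplx_C mat3 \<Rightarrow> cplx_C"
  where "J3_det X =
    (let \<xi>1 = X $ 1 $ 1; \<xi>2 = X $ 2 $ 2; \<xi>3 = X $ 3 $ 3;
         x1 = X $ 2 $ 3; x2 = X $ 3 $ 1; x3 = X $ 1 $ 2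
     in \<xi>1 * \<xi>2 * \<xi>3 + x1 * x2 * x3 + conj_C (x1 * x2 * x3)
        - \<xi>1 * x1 * conj_C x1 - \<xi>2 * x2 * conj_C x2 - \<xi>3 * x3 * conj_C x3)"

lemma J3_iff: "X \<in> J3 \<longleftrightarrow> (\<forall>i j. conj_C (X $ i $ j) = X $ j $ i)"
  by (auto simp: J3_def adj_C_def transpose_def vec_eq_iff)

lemma J3_det_in_C:
  assumes "X \<in> J3"
  shows "J3_det X \<in> range of_C"
proof -
  have "conj_C (X $ i $ i) = X $ i $ i" for i
    using assms by (metis J3_iff)
  then show ?thesis
    by (simp add: conj_C_fixed_iff[symmetric] J3_det_def Let_def algebra_simps)
qed

definition Iso_C :: "(cplx_C ^ 'n ^ 'm) set \<Rightarrow> (cplx_C ^ 'n ^ 'm \<Rightarrow> cplx_C ^ 'n ^ 'm) monoid"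
  where "Iso_C V = BijGroup V
    \<lparr>carrier := {\<alpha> \<in> Bij V. (\<forall>X\<in>V. \<forall>Y\<in>V. \<alpha> (X + Y) = \<alpha> X + \<alpha> Y) \<and>
                             (\<forall>c. \<forall>X\<in>V. \<alpha> (scale_C c X) = scale_C c (\<alpha> X))}\<rparr>"

definition E6_C :: "(cplx_C mat3 \<Rightarrow> cplx_C mat3) monoid"
  where "E6_C = Iso_C J3
    \<lparr>carrier := {\<alpha> \<in> carrier (Iso_C J3). \<forall>X\<in>J3. J3_det (\<alpha> X) = J3_det X}\<rparr>"

lemma group_E6_C: "group E6_C"
proof -
  have add: "X + Y \<in> J3" if "X \<in> J3" "Y \<in> J3" for X Y
    using that by (simp add: J3_iff)
  have scale: "scale_C c X \<in> J3" if "X \<in> J3" for c X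
    using that by (simp add: J3_iff scale_C_def conj_C_of_C_mult del: conj_C_simps(2))
  have "subgroup (carrier E6_C) (BijGroup J3)"
  proof (rule group.subgroupI[OF group_BijGroup])
    show "carrier E6_C \<subseteq> carrier (BijGroup J3)"
      by (auto simp: E6_C_def Iso_C_def BijGroup_def)
    have "(\<lambda>x\<in>J3. x) \<in> carrier E6_C"
      by (auto simp: E6_C_def Iso_C_def id_Bij add scale)
    then show "carrier E6_C \<noteq> {}" by blast
  next
    fix f assume f: "f \<in> carrier E6_C"
    then have B: "f \<in> Bij J3" by (simp add: E6_C_def Iso_C_def)
    let ?g = "inv_into J3 f"
    have g: "?g Y \<in> J3" "f (?g Y) = Y" if "Y \<in> J3" for Y
      using B that by (auto simp: Bij_def bij_betw_def inv_into_into f_inv_into_f)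
    have gf: "?g (f X) = X" if "X \<in> J3" for X
      using B that by (auto simp: Bij_def bij_betw_def)
    have "?g (X + Y) = ?g X + ?g Y" if "X \<in> J3" "Y \<in> J3" for X Y
    proof -
      have "f (?g X + ?g Y) = X + Y"
        using f that g by (simp add: E6_C_def Iso_C_def)
      then show ?thesis using gf[of "?g X + ?g Y"] that g add by simp
    qed
    moreover have "?g (scale_C c X) = scale_C c (?g X)" if "X \<in> J3" for c X
    proof -
      have "f (scale_C c (?g X)) = scale_C c X"
        using f that g by (simp add: E6_C_def Iso_C_def)
      then show ?thesis using gf[of "scale_C c (?g X)"] that g scale by simp
    qed
    moreover have "J3_det (?g X) = J3_det X" if "X \<in> J3" for X
    proof -
      have "J3_det (f (?g X)) = J3_det (?g X)"
        using f that g(1) by (simp add: E6_C_def Iso_C_def)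
      then show ?thesis using that g(2) by simp
    qed
    ultimately show "inv\<^bsub>BijGroup J3\<^esub> f \<in> carrier E6_C"
      using restrict_inv_into_Bij[OF B]
      by (auto simp: inv_BijGroup[OF B] E6_C_def Iso_C_def add scale)
  next
    fix f g assume fg: "f \<in> carrier E6_C" "g \<in> carrier E6_C"
    then have "g X \<in> J3" if "X \<in> J3" for X
      using that by (auto simp: E6_C_def Iso_C_def Bij_def bij_betw_def)
    then show "f \<otimes>\<^bsub>BijGroup J3\<^esub> g \<in> carrier E6_C"
      using fg by (auto simp: E6_C_def Iso_C_def BijGroup_def compose_Bij compose_eq add scale)
  qed
  then have "group (BijGroup J3 \<lparr>carrier := carrier E6_C\<rparr>)"
    by (rule subgroup.subgroup_is_group[OF _ group_BijGroup])
  then show ?thesis by (simp add: E6_C_def Iso_C_def)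
qed


section \<open>The groups \<open>SL(3)\<close> and \<open>SU(3)\<close>\<close>

definition SL3 :: "complex mat3 monoid"
  where "SL3 = \<lparr>carrier = {A. det A = 1}, mult = (**), one = mat 1\<rparr>"

definition SU3 :: "cplx_C mat3 monoid"
  where "SU3 = \<lparr>carrier = {A. adj_C A ** A = mat 1 \<and> det A = 1}, mult = (**), one = mat 1\<rparr>"

definition iota :: cplx_C
  where "iota = of_C (1 / 2) * (1 + tensor_C \<i> \<i>)"

definition SL3_to_SU3 :: "complex mat3 \<Rightarrow> cplx_C mat3"
  where "SL3_to_SU3 A = map_matrix (\<lambda>a. iota * of_C a) A
                      + map_matrix (\<lambda>a. conj_C iota * of_C a) (transpose (matrix_inv A))"

lemma group_SL3: "group SL3"
proof (rule groupI)
  fix A assume "A \<in> carrier SL3"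
  then have d: "det A = 1" by (simp add: SL3_def)
  then obtain B where B: "B ** A = mat 1"
    using invertible_det_nz[of A] by (auto simp: invertible_def)
  then have "det B = 1" using d by (metis det_I det_mul mult.right_neutral)
  then show "\<exists>B\<in>carrier SL3. B \<otimes>\<^bsub>SL3\<^esub> A = \<one>\<^bsub>SL3\<^esub>"
    using B by (auto simp: SL3_def)
qed (auto simp: SL3_def det_mul matrix_mul_assoc)

text \<open>
  \<^const>\<open>iota\<close> and its conjugate are orthogonal idempotents with sum \<open>1\<close>; the following are the two
  coordinate functions with respect to them.
\<close>

definition coord1 :: "cplx_C \<Rightarrow> complex" where "coord1 x = fst_C x - \<i> * snd_C x"
definition coord2 :: "cplx_C \<Rightarrow> complex" where "coord2 x = fst_C x + \<i> * snd_C x"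

lemma coord_hom [simp]:
  "coord1 (x + y) = coord1 x + coord1 y" "coord2 (x + y) = coord2 x + coord2 y"
  "coord1 (x - y) = coord1 x - coord1 y" "coord2 (x - y) = coord2 x - coord2 y"
  "coord1 (x * y) = coord1 x * coord1 y" "coord2 (x * y) = coord2 x * coord2 y"
  "coord1 0 = 0" "coord2 0 = 0" "coord1 1 = 1" "coord2 1 = 1"
  "coord1 (of_C c) = c" "coord2 (of_C c) = c"
  "coord1 (conj_C x) = coord2 x" "coord2 (conj_C x) = coord1 x"
  "coord1 iota = 1" "coord2 iota = 0"
  by (simp_all add: coord1_def coord2_def cplx_C_defs iota_def algebra_simps)

lemma coord_eqI: "coord1 x = coord1 y \<Longrightarrow> coord2 x = coord2 y \<Longrightarrow> x = y"
proof (rule cplx_C.expand)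
  assume *: "coord1 x = coord1 y" "coord2 x = coord2 y"
  then have "2 * fst_C x = 2 * fst_C y" "2 * \<i> * snd_C x = 2 * \<i> * snd_C y"
    unfolding coord1_def coord2_def by algebra+
  then show "fst_C x = fst_C y \<and> snd_C x = snd_C y" by simp
qed

lemma map_matrix_coord_eqI:
  assumes "map_matrix coord1 A = map_matrix coord1 B" "map_matrix coord2 A = map_matrix coord2 B"
  shows "A = B"
  using assms by (auto simp: vec_eq_iff intro: coord_eqI)

lemma map_matrix_coord_hom:
  fixes A B :: "cplx_C mat3"
  shows "map_matrix coord1 (A ** B) = map_matrix coord1 A ** map_matrix coord1 B"
    and "map_matrix coord2 (A ** B) = map_matrix coord2 A ** map_matrix coord2 B"
    and "map_matrix coord1 (mat 1 :: cplx_C mat3) = mat 1"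
    and "map_matrix coord2 (mat 1 :: cplx_C mat3) = mat 1"
    and "map_matrix coord1 (adj_C A) = transpose (map_matrix coord2 A)"
    and "map_matrix coord2 (adj_C A) = transpose (map_matrix coord1 A)"
    and "det (map_matrix coord1 A) = coord1 (det A)"
    and "det (map_matrix coord2 A) = coord2 (det A)"
  by (simp_all add: vec_eq_iff matrix_matrix_mult_def mat_def adj_C_def transpose_def sum_3 det_3)

lemma map_matrix_coord_SL3_to_SU3:
  "map_matrix coord1 (SL3_to_SU3 A) = A"
  "map_matrix coord2 (SL3_to_SU3 A) = transpose (matrix_inv A)"
  by (simp_all add: SL3_to_SU3_def vec_eq_iff)

lemma SL3_matrix_inv:
  fixes A :: "complex mat3"
  assumes "det A = 1"
  shows "A ** matrix_inv A = mat 1" "matrix_inv A ** A = mat 1"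
proof -
  have "\<exists>B. A ** B = mat 1 \<and> B ** A = mat 1"
    using assms invertible_det_nz[of A] by (auto simp: invertible_def)
  from someI_ex[OF this] show "A ** matrix_inv A = mat 1" "matrix_inv A ** A = mat 1"
    by (simp_all add: matrix_inv_def)
qed

lemma SL3_matrix_inv_unique:
  fixes A :: "complex mat3"
  assumes "det A = 1" "B ** A = mat 1"
  shows "matrix_inv A = B"
  by (metis SL3_matrix_inv(1)[OF assms(1)] assms(2) matrix_mul_assoc matrix_mul_lid matrix_mul_rid)

theorem SL3_to_SU3_iso: "SL3_to_SU3 \<in> iso SL3 SU3"
proof -
  have SU: "SL3_to_SU3 A \<in> carrier SU3" if d: "det A = 1" for A
  proof -
    have "det (matrix_inv A) = 1"
      using SL3_matrix_inv[OF d] d by (metis det_I det_mul mult_1)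
    then have "det (SL3_to_SU3 A) = 1"
      using d by (intro coord_eqI)
        (simp_all flip: map_matrix_coord_hom add: map_matrix_coord_SL3_to_SU3 det_transpose)
    moreover have "adj_C (SL3_to_SU3 A) ** SL3_to_SU3 A = mat 1"
      by (rule map_matrix_coord_eqI)
        (simp_all add: map_matrix_coord_hom map_matrix_coord_SL3_to_SU3 SL3_matrix_inv[OF d]
          transpose_mat flip: matrix_transpose_mul)
    ultimately show ?thesis by (simp add: SU3_def)
  qed
  have mult: "SL3_to_SU3 (A ** B) = SL3_to_SU3 A ** SL3_to_SU3 B"
    if d: "det A = 1" "det B = 1" for A B
  proof -
    have "matrix_inv B ** matrix_inv A ** (A ** B) = mat 1"
      by (metis SL3_matrix_inv(2)[OF d(1)] SL3_matrix_inv(2)[OF d(2)] matrix_mul_assoc matrix_mul_lid)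
    then have "matrix_inv (A ** B) = matrix_inv B ** matrix_inv A"
      using d by (intro SL3_matrix_inv_unique) (simp_all add: det_mul)
    then show ?thesis
      by (intro map_matrix_coord_eqI)
        (simp_all add: map_matrix_coord_hom map_matrix_coord_SL3_to_SU3 matrix_transpose_mul)
  qed
  have surj: "U \<in> SL3_to_SU3 ` carrier SL3" if "U \<in> carrier SU3" for U
  proof -
    let ?A = "map_matrix coord1 U" and ?B = "map_matrix coord2 U"
    have U: "adj_C U ** U = mat 1" "det U = 1" using that by (simp_all add: SU3_def)
    have d: "det ?A = 1" using U by (simp add: map_matrix_coord_hom)
    have "transpose ?B ** ?A = mat 1"
      using arg_cong[OF U(1), of "map_matrix coord1"] by (simp add: map_matrix_coord_hom)
    then have "matrix_inv ?A = transpose ?B" by (rule SL3_matrix_inv_unique[OF d])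
    then have "SL3_to_SU3 ?A = U"
      by (intro map_matrix_coord_eqI) (simp_all add: map_matrix_coord_SL3_to_SU3 transpose_transpose)
    then show ?thesis using d by (force simp: SL3_def)
  qed
  have "inj SL3_to_SU3"
    by (rule injI) (metis map_matrix_coord_SL3_to_SU3(1))
  then show ?thesis
    using SU mult surj
    by (auto simp: iso_def hom_def bij_betw_def SL3_def SU3_def intro: inj_on_subset)
qed

definition Z3 :: "complex \<Rightarrow> (complex mat3 \<times> complex mat3) set"
  where "Z3 \<omega> = {(mat 1, mat 1), (mat \<omega>, mat \<omega>), (mat (\<omega>\<^sup>2), mat (\<omega>\<^sup>2))}"

lemma Z3_normal:
  assumes "\<omega> ^ 3 = 1"
  shows "Z3 \<omega> \<lhd> (SL3 \<times>\<times> SL3)"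
proof -
  have G: "group (SL3 \<times>\<times> SL3)" by (simp add: DirProd_group group_SL3)
  have mat_mul: "mat a ** A = A ** mat a" "mat a ** mat b = (mat (a * b) :: complex mat3)"
    for a b and A :: "complex mat3"
    by (simp_all add: vec_eq_iff matrix_matrix_mult_def mat_def sum_3 forall_3)
  have w: "\<omega> ^ 4 = \<omega>" "\<omega> * \<omega>\<^sup>2 = 1" "\<omega>\<^sup>2 * \<omega> = 1" "\<omega>\<^sup>2 * \<omega>\<^sup>2 = \<omega>"
    using assms by algebra+
  have d: "det (mat a :: complex mat3) = a ^ 3" for a
    by (simp add: det_3 mat_def power3_eq_cube)
  have w6: "(\<omega>\<^sup>2) ^ 3 = 1"
    using assms by (metis power_commutes power_mult mult.commute power_one)
  have sub: "Z3 \<omega> \<subseteq> carrier (SL3 \<times>\<times> SL3)"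
    using assms w6 by (auto simp: Z3_def SL3_def d simp del: power_mult_numeral)
  have inv: "inv\<^bsub>SL3 \<times>\<times> SL3\<^esub> z \<in> Z3 \<omega>" if z: "z \<in> Z3 \<omega>" for z
  proof -
    have "\<exists>y\<in>Z3 \<omega>. y \<otimes>\<^bsub>SL3 \<times>\<times> SL3\<^esub> z = \<one>\<^bsub>SL3 \<times>\<times> SL3\<^esub>"
      using z by (auto simp: Z3_def DirProd_def SL3_def mat_mul(2) w)
    then obtain y where "y \<in> Z3 \<omega>" "y \<otimes>\<^bsub>SL3 \<times>\<times> SL3\<^esub> z = \<one>\<^bsub>SL3 \<times>\<times> SL3\<^esub>" by blast
    then show ?thesis using group.inv_equality[OF G, of y z] sub z by auto
  qed
  have "subgroup (Z3 \<omega>) (SL3 \<times>\<times> SL3)"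
  proof (rule group.subgroupI[OF G sub _ inv])
    show "Z3 \<omega> \<noteq> {}" by (simp add: Z3_def)
    show "a \<otimes>\<^bsub>SL3 \<times>\<times> SL3\<^esub> b \<in> Z3 \<omega>" if "a \<in> Z3 \<omega>" "b \<in> Z3 \<omega>" for a b
      using that by (auto simp: Z3_def DirProd_def SL3_def mat_mul(2) w power2_eq_square[symmetric])
  qed
  moreover have "x \<otimes>\<^bsub>SL3 \<times>\<times> SL3\<^esub> h \<otimes>\<^bsub>SL3 \<times>\<times> SL3\<^esub> inv\<^bsub>SL3 \<times>\<times> SL3\<^esub> x \<in> Z3 \<omega>"
    if x: "x \<in> carrier (SL3 \<times>\<times> SL3)" and h: "h \<in> Z3 \<omega>" for x h
  proof -
    obtain a where "h = (mat a, mat a)" using h by (auto simp: Z3_def)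
    then have "x \<otimes>\<^bsub>SL3 \<times>\<times> SL3\<^esub> h = h \<otimes>\<^bsub>SL3 \<times>\<times> SL3\<^esub> x"
      using mat_mul(1)[of a] by (cases x) (simp add: DirProd_def SL3_def)
    moreover have "h \<in> carrier (SL3 \<times>\<times> SL3)" using sub h by blast
    ultimately have "x \<otimes>\<^bsub>SL3 \<times>\<times> SL3\<^esub> h \<otimes>\<^bsub>SL3 \<times>\<times> SL3\<^esub> inv\<^bsub>SL3 \<times>\<times> SL3\<^esub> x = h"
      using x group.inv_solve_right'[OF G, of h "x \<otimes>\<^bsub>SL3 \<times>\<times> SL3\<^esub> h" x]
        monoid.m_closed[OF group.is_monoid[OF G], of h x] by simp
    then show ?thesis using h by simp
  qed
  ultimately show ?thesis by (simp add: group.normal_inv_iff[OF G])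
qed

definition SL3_sq_mod_Z3 :: "complex \<Rightarrow> (complex mat3 \<times> complex mat3) set monoid"
  where "SL3_sq_mod_Z3 \<omega> = (SL3 \<times>\<times> SL3) Mod Z3 \<omega>"


section \<open>The action of \<open>\<epsilon>\<close> and the semidirect product\<close>

definition eps :: "cplx_C mat3 \<times> cplx_C mat3 \<Rightarrow> cplx_C mat3 \<times> cplx_C mat3"
  where "eps = (\<lambda>(A, B). (map_matrix conj_C B, map_matrix conj_C A))"

definition Z2 :: "(cplx_C mat3 \<times> cplx_C mat3 \<Rightarrow> cplx_C mat3 \<times> cplx_C mat3) monoid"
  where "Z2 = \<lparr>carrier = {id, eps}, mult = (\<circ>), one = id\<rparr>"

text \<open>
  An element \<open>h\<close> of \<^term>\<open>Z2\<close> acts on \<open>SU(3) \<times> SU(3)\<close>, hence, through the identification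
  \<^term>\<open>SL3_to_SU3\<close>, on \<open>SL(3) \<times> SL(3)\<close>; a coset \<open>S\<close> is sent to its image under the latter action.
\<close>

definition Z2_act ::
  "complex \<Rightarrow> (cplx_C mat3 \<times> cplx_C mat3 \<Rightarrow> cplx_C mat3 \<times> cplx_C mat3) \<Rightarrow>
    (complex mat3 \<times> complex mat3) set \<Rightarrow> (complex mat3 \<times> complex mat3) set"
  where "Z2_act \<omega> h =
    (\<lambda>S \<in> carrier (SL3_sq_mod_Z3 \<omega>).
       {p \<in> carrier (SL3 \<times>\<times> SL3).
          map_prod SL3_to_SU3 SL3_to_SU3 p \<in> h ` map_prod SL3_to_SU3 SL3_to_SU3 ` S})"

definition semidirect ::
  "('a, 'c) monoid_scheme \<Rightarrow> ('b, 'd) monoid_scheme \<Rightarrow> ('b \<Rightarrow> 'a \<Rightarrow> 'a) \<Rightarrow> ('a \<times> 'b) monoid"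
  where "semidirect N H \<theta> =
    \<lparr>carrier = carrier N \<times> carrier H,
     mult = \<lambda>(n, h) (n', h'). (n \<otimes>\<^bsub>N\<^esub> \<theta> h n', h \<otimes>\<^bsub>H\<^esub> h'),
     one = (\<one>\<^bsub>N\<^esub>, \<one>\<^bsub>H\<^esub>)\<rparr>"

end

theory Submission
  imports Defs
begin

text \<open>
  The coordinate \<^const>\<open>coord1\<close> identifies the Jordan algebra with the complex 3 by 3 matrices and its
  determinant with the ordinary one, so \<^const>\<open>E6_C\<close> is the group of linear bijections of
  \<open>M(3, C)\<close> preserving \<open>det\<close>.  By Frobenius these are the maps \<open>Y \<mapsto> P Y Q\<close> and \<open>Y \<mapsto> P Y\<^sup>T Q\<close> with
  \<open>det P det Q = 1\<close>: a preserver maps matrices of rank at most 1 to such matrices, since these are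
  the \<open>A\<close> for which \<open>det (X + t A)\<close> has no quadratic term in \<open>t\<close> for any \<open>X\<close>; after normalising the
  images of the diagonal matrix units, the rank 1 sums of matrix units determine the map.  Scaling
  by a cube root gives \<open>Y \<mapsto> A Y B\<^sup>-\<^sup>1\<close> with \<open>A, B\<close> in \<open>SL(3)\<close>, which is trivial exactly on \<open>\<int>\<^sub>3\<close>;
  conjugation by the transposition sends \<open>(A, B)\<close> to the pair of inverse transposes of \<open>B\<close> and \<open>A\<close>,
  which is the action of \<open>\<epsilon>\<close>.
\<close>

section \<open>Linear maps preserving the determinant\<close>

text \<open>Homogeneity is over complex scalars acting entrywise, which is the form that
  \<open>scale_C\<close> takes under \<open>coord1\<close>.\<close>

definition det_preserver :: "(complex mat3 \<Rightarrow> complex mat3) \<Rightarrow> bool"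
  where "det_preserver T \<longleftrightarrow> bij T \<and> (\<forall>X Y. T (X + Y) = T X + T Y) \<and>
    (\<forall>c X. T (map_matrix ((*) c) X) = map_matrix ((*) c) (T X)) \<and> (\<forall>X. det (T X) = det X)"

lemma det_preserverD:
  assumes "det_preserver T"
  shows "bij T" "T (X + Y) = T X + T Y" "T (map_matrix ((*) c) X) = map_matrix ((*) c) (T X)"
    "det (T X) = det X"
  using assms by (auto simp: det_preserver_def)

lemma det_preserver_compose:
  "det_preserver S \<Longrightarrow> det_preserver T \<Longrightarrow> det_preserver (S \<circ> T)"
  by (simp add: det_preserver_def bij_comp)

lemma mat3_inverse:
  fixes A :: "complex mat3"
  assumes "det A \<noteq> 0"
  obtains B where "A ** B = mat 1" "B ** A = mat 1"
  using assms invertible_det_nz[of A] by (auto simp: invertible_def)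

lemma det_preserver_mult:
  fixes A B :: "complex mat3"
  assumes "det A * det B = 1"
  shows "det_preserver (\<lambda>Y. A ** Y ** B)"
proof -
  have "det A \<noteq> 0" "det B \<noteq> 0" using assms by auto
  then obtain A' B' where inv: "A ** A' = mat 1" "A' ** A = mat 1" "B ** B' = mat 1" "B' ** B = mat 1"
    by (metis mat3_inverse)
  have "A' ** (A ** Y ** B) ** B' = Y" "A ** (A' ** Y ** B') ** B = Y" for Y
    by (metis inv matrix_mul_assoc matrix_mul_lid matrix_mul_rid)+
  then have "bij (\<lambda>Y. A ** Y ** B)"
    by (intro o_bij[of "\<lambda>Y. A' ** Y ** B'"]) (auto simp: fun_eq_iff)
  moreover have "A ** (X + Y) ** B = A ** X ** B + A ** Y ** B" for X Y
    by (simp add: vec_eq_iff matrix_matrix_mult_def sum_3 algebra_simps)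
  moreover have "A ** map_matrix ((*) c) X ** B = map_matrix ((*) c) (A ** X ** B)" for c X
    by (simp add: vec_eq_iff matrix_matrix_mult_def sum_3 algebra_simps)
  moreover have "det (A ** X ** B) = det X" for X
    using assms by (simp add: det_mul)
  ultimately show ?thesis by (simp add: det_preserver_def)
qed

lemma det_preserver_transpose: "det_preserver transpose"
proof -
  have "bij (transpose :: complex mat3 \<Rightarrow> _)"
    by (rule o_bij[of transpose]) (auto simp: fun_eq_iff transpose_transpose)
  then show ?thesis
    using det_transpose by (simp add: det_preserver_def vec_eq_iff) (simp add: transpose_def)
qed

text \<open>Rank at most 1, encoded by polynomial identities between entries; the instances with
  \<open>i = k\<close> or \<open>j = l\<close> are trivial.\<close>

definition minors_vanish :: "complex mat3 \<Rightarrow> bool"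
  where "minors_vanish A \<longleftrightarrow> (\<forall>i j k l. A $ i $ j * A $ k $ l = A $ i $ l * A $ k $ j)"

definition munit :: "3 \<Rightarrow> 3 \<Rightarrow> complex mat3"
  where "munit i j = (\<chi> k l. if k = i \<and> l = j then 1 else 0)"

lemma ex_3: "(\<exists>i::3. P i) \<longleftrightarrow> P 1 \<or> P 2 \<or> P 3"
  by (metis exhaust_3)

lemma munit_nth [simp]: "munit i j $ k $ l = (if k = i \<and> l = j then 1 else 0)"
  by (simp add: munit_def)

text \<open>The second difference of \<open>t \<mapsto> det (X + t A)\<close> is twice the pairing of \<open>X\<close> with the cofactors of \<open>A\<close>.\<close>

lemma minors_vanish_iff_det:
  "minors_vanish A \<longleftrightarrow> (\<forall>X. det (X + A) + det (X - A) = 2 * det X)"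
proof
  assume "minors_vanish A"
  then have *: "A $ i $ j * A $ k $ l = A $ i $ l * A $ k $ j" for i j k l
    by (simp add: minors_vanish_def)
  show "\<forall>X. det (X + A) + det (X - A) = 2 * det X"
  proof
    fix X
    have "det (X + A) + det (X - A) - 2 * det X =
      2 * (X$1$1 * (A$2$2 * A$3$3 - A$2$3 * A$3$2) + X$1$2 * (A$2$3 * A$3$1 - A$2$1 * A$3$3)
         + X$1$3 * (A$2$1 * A$3$2 - A$2$2 * A$3$1) + X$2$1 * (A$1$3 * A$3$2 - A$1$2 * A$3$3)
         + X$2$2 * (A$1$1 * A$3$3 - A$1$3 * A$3$1) + X$2$3 * (A$1$2 * A$3$1 - A$1$1 * A$3$2)
         + X$3$1 * (A$1$2 * A$2$3 - A$1$3 * A$2$2) + X$3$2 * (A$1$3 * A$2$1 - A$1$1 * A$2$3)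
         + X$3$3 * (A$1$1 * A$2$2 - A$1$2 * A$2$1))"
      by (simp add: det_3 algebra_simps)
    also have "\<dots> = 0"
      using *[of 2 2 3 3] *[of 2 3 3 1] *[of 2 1 3 2] *[of 1 3 3 2] *[of 1 1 3 3] *[of 1 2 3 1]
        *[of 1 2 2 3] *[of 1 3 2 1] *[of 1 1 2 2] by simp
    finally show "det (X + A) + det (X - A) = 2 * det X" by simp
  qed
next
  assume *: "\<forall>X. det (X + A) + det (X - A) = 2 * det X"
  \<comment> \<open>A matrix unit as \<open>X\<close> isolates one cofactor of \<open>A\<close> in
    the pairing.\<close>
  have d: "det (munit a b + A) + det (munit a b - A) = 2 * det (munit a b)" for a b
    using * by blast
  have "A$2$2 * A$3$3 = A$2$3 * A$3$2" "A$2$3 * A$3$1 = A$2$1 * A$3$3"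
    "A$2$1 * A$3$2 = A$2$2 * A$3$1" "A$1$3 * A$3$2 = A$1$2 * A$3$3"
    "A$1$1 * A$3$3 = A$1$3 * A$3$1" "A$1$2 * A$3$1 = A$1$1 * A$3$2"
    "A$1$2 * A$2$3 = A$1$3 * A$2$2" "A$1$3 * A$2$1 = A$1$1 * A$2$3"
    "A$1$1 * A$2$2 = A$1$2 * A$2$1"
    using d[of 1 1] d[of 1 2] d[of 1 3] d[of 2 1] d[of 2 2] d[of 2 3] d[of 3 1] d[of 3 2] d[of 3 3]
    by (simp_all add: det_3 algebra_simps)
  then show "minors_vanish A"
    by (simp add: minors_vanish_def forall_3 mult.commute)
qed

text \<open>Around a nonzero entry at \<open>(a, b)\<close>, the minors express every entry through
  column \<open>b\<close> and row \<open>a\<close>, so these two, the row divided by that entry, are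
  the factors.\<close>

lemma minors_vanish_outer:
  assumes "minors_vanish A"
  obtains u v where "\<And>i j. A $ i $ j = u $ i * v $ j"
proof (cases "\<exists>a b. A $ a $ b \<noteq> 0")
  case True
  then obtain a b where ab: "A $ a $ b \<noteq> 0" by blast
  have "A $ i $ j = (\<chi> i. A $ i $ b) $ i * (\<chi> j. A $ a $ j / A $ a $ b) $ j" for i j
  proof -
    have "A $ i $ j * A $ a $ b = A $ i $ b * A $ a $ j"
      using assms unfolding minors_vanish_def by blast
    then show ?thesis using ab by (simp add: field_simps)
  qed
  then show ?thesis using that by blast
next
  case False
  then show ?thesis using that[of 0 0] by simp
qed

text \<open>The criterion \<open>minors_vanish_iff_det\<close> involves only sums, differences and
  determinants, all respected by \<open>T\<close>; by surjectivity every test matrix is some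
  \<open>T X\<close>.\<close>

lemma det_preserver_minors:
  assumes T: "det_preserver T" and A: "minors_vanish A"
  shows "minors_vanish (T A)"
  unfolding minors_vanish_iff_det
proof
  fix Y
  obtain X where Y: "Y = T X"
    using det_preserverD(1)[OF T] by (metis bij_pointE)
  have "T (X - A) = T X - T A"
    using det_preserverD(2)[OF T, of "X - A" A] by simp
  then have "det (T X + T A) + det (T X - T A) = det (X + A) + det (X - A)"
    using det_preserverD[OF T] by metis
  also have "\<dots> = 2 * det (T X)"
    using A det_preserverD(4)[OF T] by (simp add: minors_vanish_iff_det)
  finally show "det (Y + T A) + det (Y - T A) = 2 * det Y" by (simp add: Y)
qed

section \<open>Classification of the preservers through matrix units\<close>

lemma det_preserver_expand:
  assumes "det_preserver T"
  shows "T Y $ k $ l = (\<Sum>i\<in>UNIV. \<Sum>j\<in>UNIV. Y $ i $ j * T (munit i j) $ k $ l)"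
proof -
  have T: "T (X + Y) = T X + T Y" "T (map_matrix ((*) c) X) = map_matrix ((*) c) (T X)" for X Y c
    using det_preserverD[OF assms] by auto
  have "Y = (map_matrix ((*) (Y$1$1)) (munit 1 1) + map_matrix ((*) (Y$1$2)) (munit 1 2)
      + map_matrix ((*) (Y$1$3)) (munit 1 3)) + (map_matrix ((*) (Y$2$1)) (munit 2 1)
      + map_matrix ((*) (Y$2$2)) (munit 2 2) + map_matrix ((*) (Y$2$3)) (munit 2 3))
      + (map_matrix ((*) (Y$3$1)) (munit 3 1) + map_matrix ((*) (Y$3$2)) (munit 3 2)
      + map_matrix ((*) (Y$3$3)) (munit 3 3))"
    by (simp add: vec_eq_iff forall_3)
  from arg_cong[OF this, of "\<lambda>Z. T Z $ k $ l"] show ?thesis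
    by (simp add: T sum_3)
qed

text \<open>Off the diagonal, \<open>munit i j\<close> goes to a nonzero multiple of either
  \<open>munit i j\<close> or \<open>munit j i\<close>. Rank 1 sums within a row or a column force
  the same alternative everywhere. Up to transposition \<open>T\<close> then multiplies entries by
  coefficients, and these coefficients form a rank 1 matrix.\<close>

lemma det_preserver_normalized:
  assumes T: "det_preserver T" and diag: "\<And>i. T (munit i i) = munit i i"
  obtains P Q where "(\<forall>Y. T Y = P ** Y ** Q) \<or> (\<forall>Y. T Y = P ** transpose Y ** Q)"
proof -
  have rk: "T A $ i $ j * T A $ k $ l = T A $ i $ l * T A $ k $ j" if "minors_vanish A" for A i j k l
    using det_preserver_minors[OF T that] by (auto simp: minors_vanish_def)
  have rk_add: "(T A $ i $ j + T B $ i $ j) * (T A $ k $ l + T B $ k $ l) =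
      (T A $ i $ l + T B $ i $ l) * (T A $ k $ j + T B $ k $ j)"
    if "minors_vanish (A + B)" for A B i j k l
    using rk[OF that] det_preserverD(2)[OF T] by simp
  have units: "minors_vanish (munit i j)" "minors_vanish (munit i j + munit i k)"
    "minors_vanish (munit i j + munit k j)" for i j k
    by (auto simp: minors_vanish_def)
  \<comment> \<open>On rows \<open>i\<close>, \<open>k\<close> and columns \<open>i\<close>,
    \<open>l\<close>, the minors of the images of \<open>munit i i + munit i j\<close> and of
    \<open>munit i j\<close> differ exactly by this entry. The next fact does the same with
    \<open>munit j j\<close>.\<close>
  have z1: "T (munit i j) $ k $ l = 0" if "i \<noteq> j" "k \<noteq> i" "l \<noteq> i" for i j k l
    using rk_add[OF units(2)[of i i j], of i i k l] rk[OF units(1)[of i j], of i i k l] that diag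
    by (simp add: algebra_simps)
  have z2: "T (munit i j) $ k $ l = 0" if "i \<noteq> j" "k \<noteq> j" "l \<noteq> j" for i j k l
    using rk_add[OF units(3)[of j j i], of j j k l] rk[OF units(1)[of i j], of j j k l] that diag
    by (simp add: algebra_simps)
  \<comment> \<open>A surviving position must use both indices \<open>i\<close> and
    \<open>j\<close>, which leaves \<open>(i, j)\<close> and \<open>(j, i)\<close>.\<close>
  have z: "T (munit i j) $ k $ l = 0" if "i \<noteq> j" "\<not> (k = i \<and> l = j)" "\<not> (k = j \<and> l = i)" for i j k l
    using z1[of i j k l] z2[of i j k l] that by blast
  define a where "a i j = T (munit i j) $ i $ j" for i j
  define b where "b i j = T (munit i j) $ j $ i" for i j
  have ab0: "a i j * b i j = 0" if "i \<noteq> j" for i j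
    using rk[OF units(1)[of i j], of i j j i] z[of i j i i] that by (simp add: a_def b_def)
  have ab: "a i j \<noteq> 0 \<or> b i j \<noteq> 0" if "i \<noteq> j" for i j
  proof (rule ccontr)
    assume "\<not> ?thesis"
    then have T0: "T (munit i j) $ k $ l = 0" for k l
      using z[of i j k l] that by (auto simp: a_def b_def)
    have "T (munit i j) = T (map_matrix ((*) 0) (munit i j))"
      using T0 by (simp add: det_preserverD(3)[OF T] vec_eq_iff)
    then have "munit i j = map_matrix ((*) 0) (munit i j)"
      using det_preserverD(1)[OF T] by (meson bij_is_inj injD)
    from arg_cong[OF this, of "\<lambda>A. A $ i $ j"] show False by simp
  qed
  \<comment> \<open>In the image of \<open>munit i j + munit i k\<close> the minor on rows
    \<open>i\<close>, \<open>k\<close> and columns \<open>j\<close>, \<open>i\<close> reduces to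
    this product; \<open>col\<close> is the analogue for two units in one column.\<close>
  have row: "a i j * b i k = 0" if "i \<noteq> j" "i \<noteq> k" "j \<noteq> k" for i j k
    using rk_add[OF units(2)[of i j k], of i j k i] that
      z[of i j i i] z[of i k i i] z[of i j k i] z[of i k i j]
    by (auto simp: a_def b_def)
  have col: "a i j * b k j = 0" if "i \<noteq> j" "k \<noteq> j" "i \<noteq> k" for i j k
    using rk_add[OF units(3)[of i j k], of i j j k] that
      z[of i j j j] z[of k j j j] z[of i j j k] z[of k j i j]
    by (auto simp: a_def b_def)
  have step: "a i k \<noteq> 0" if "a i j \<noteq> 0" "i \<noteq> j" "i \<noteq> k" for i j k
    using row[of i j k] ab[of i k] that by auto
  have step': "a k j \<noteq> 0" if "a i j \<noteq> 0" "i \<noteq> j" "k \<noteq> j" for i j k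
    using col[of i j k] ab[of k j] that by auto
  \<comment> \<open>Stated for an arbitrary \<open>S\<close>, since it serves both \<open>T\<close>
    and its composition with the transposition.\<close>
  have diagonal: "\<exists>P Q. \<forall>Y. S Y = P ** Y ** Q"
    if S: "det_preserver S" and c: "\<And>i j k l. S (munit i j) $ k $ l = (if k = i \<and> l = j then c i j else 0)"
    for S and c :: "3 \<Rightarrow> 3 \<Rightarrow> complex"
  proof -
    have SY: "S Y $ k $ l = c k l * Y $ k $ l" for Y k l
      unfolding det_preserver_expand[OF S, of Y] c
      using exhaust_3[of k] exhaust_3[of l] by (elim disjE) (simp_all add: sum_3)
    \<comment> \<open>The all-ones matrix has rank 1 and its image is the matrix of coefficients
      \<open>c\<close>, which therefore factors.\<close>
    have "minors_vanish (S (\<chi> i j. 1))"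
      by (rule det_preserver_minors[OF S]) (simp add: minors_vanish_def)
    then obtain u v where "\<And>i j. S (\<chi> i j. 1) $ i $ j = u $ i * v $ j"
      using minors_vanish_outer by blast
    then have uv: "c i j = u $ i * v $ j" for i j by (simp add: SY)
    have "S Y = (\<chi> i j. if i = j then u $ i else 0) ** Y ** (\<chi> i j. if i = j then v $ i else 0)" for Y
      by (simp add: vec_eq_iff SY uv matrix_matrix_mult_def sum_3 forall_3)
    then show ?thesis by blast
  qed
  show ?thesis
  proof (cases "\<exists>i j. i \<noteq> j \<and> a i j \<noteq> 0")
    case True
    then obtain i j where ij: "i \<noteq> j" "a i j \<noteq> 0" by blast
    \<comment> \<open>Row \<open>j\<close> cannot be entered through column \<open>j\<close>, as
      \<open>(j, j)\<close> is a diagonal position; the third index gives the path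
      \<open>(i, j)\<close>, \<open>(i, m)\<close>, \<open>(j, m)\<close>.\<close>
    obtain m where m: "m \<noteq> i" "m \<noteq> j"
    proof -
      have "\<exists>m. m \<noteq> i \<and> m \<noteq> j"
        using exhaust_3[of i] exhaust_3[of j] by (elim disjE) (simp_all add: ex_3)
      then show ?thesis using that by blast
    qed
    have "a p q \<noteq> 0" if "p \<noteq> q" for p q
    proof (cases "p = j")
      case True
      have "a i m \<noteq> 0" using step ij m by metis
      then have "a j m \<noteq> 0" using step' m by metis
      then show ?thesis using step True m that by metis
    next
      case False
      then have "a p j \<noteq> 0" using step' ij by metis
      then show ?thesis using step False that by metis
    qed
    then have "b i j = 0" if "i \<noteq> j" for i j
      using ab0[OF that] that by auto
    then have "T (munit i j) $ k $ l = (if k = i \<and> l = j then a i j else 0)" for i j k l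
      using z[of i j k l] by (cases "i = j") (auto simp: a_def b_def diag)
    from diagonal[OF T this] that show ?thesis by blast
  next
    case False
    then have a0: "a i j = 0" if "i \<noteq> j" for i j using that by blast
    have "(transpose \<circ> T) (munit i j) $ k $ l = (if k = i \<and> l = j then b i j else 0)" for i j k l
    proof (cases "i = j")
      case True
      then show ?thesis by (simp add: b_def diag transpose_def)
    next
      case False
      then show ?thesis
        using z[OF False, of l k] a0[OF False] by (auto simp: a_def b_def transpose_def)
    qed
    from diagonal[OF det_preserver_compose[OF det_preserver_transpose T] this]
    obtain P Q where "\<And>Y. transpose (T Y) = P ** Y ** Q" by auto
    then have "T Y = transpose Q ** transpose Y ** transpose P" for Y
      by (metis matrix_mul_assoc matrix_transpose_mul transpose_transpose)
    with that show ?thesis by blast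
  qed
qed

text \<open>Multiplying by suitable invertible matrices on both sides makes the map fix the diagonal
  matrix units, which reduces to the normalised case.\<close>

lemma frobenius_det_preserver:
  assumes T: "det_preserver T"
  obtains P Q where "det P * det Q = 1"
    "(\<forall>Y. T Y = P ** Y ** Q) \<or> (\<forall>Y. T Y = P ** transpose Y ** Q)"
proof -
  have "\<exists>u v. \<forall>k l. T (munit i i) $ k $ l = u $ k * v $ l" for i
  proof -
    have "minors_vanish (munit i i)" by (auto simp: minors_vanish_def)
    from minors_vanish_outer[OF det_preserver_minors[OF T this]] show ?thesis by metis
  qed
  then obtain u v where uv: "\<And>i k l. T (munit i i) $ k $ l = u i $ k * v i $ l" by metis
  \<comment> \<open>The column factors of the images of the diagonal units become the columns of
    \<open>U\<close>, the row factors the rows of \<open>V\<close>. Summing over the units gives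
    \<open>T (mat 1) = U ** V\<close>, so both are invertible.\<close>
  define U V where "U = (\<chi> k i. u i $ k)" and "V = (\<chi> i l. v i $ l)"
  have E: "T (munit i i) = U ** munit i i ** V" for i
    using exhaust_3[of i]
    by (auto simp: vec_eq_iff uv U_def V_def matrix_matrix_mult_def sum_3)
  have "T (mat 1) = U ** V"
  proof -
    have "T (mat 1) $ k $ l = (U ** V) $ k $ l" for k l
      unfolding det_preserver_expand[OF T, of "mat 1"]
      by (simp add: mat_def uv U_def V_def matrix_matrix_mult_def sum_3)
    then show ?thesis by (simp add: vec_eq_iff)
  qed
  then have dUV: "det U * det V = 1"
    by (metis det_I det_mul det_preserverD(4)[OF T])
  then have "det U \<noteq> 0" "det V \<noteq> 0" by auto
  then obtain U' V' where inv: "U' ** U = mat 1" "U ** U' = mat 1" "V ** V' = mat 1" "V' ** V = mat 1"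
    by (metis mat3_inverse)
  have "det U' * det U * (det V * det V') = 1" by (metis inv(1,3) det_mul det_I mult_1)
  then have "det U' * det V' = 1" using dUV by algebra
  from det_preserver_compose[OF det_preserver_mult[OF this] T]
  have S: "det_preserver (\<lambda>Y. U' ** T Y ** V')" by (simp add: o_def)
  have cancel: "U' ** (U ** Y ** V) ** V' = Y" "U ** (U' ** Y ** V') ** V = Y" for Y
    by (metis inv matrix_mul_assoc matrix_mul_lid matrix_mul_rid)+
  obtain P Q where PQ: "(\<forall>Y. U' ** T Y ** V' = P ** Y ** Q) \<or> (\<forall>Y. U' ** T Y ** V' = P ** transpose Y ** Q)"
    using det_preserver_normalized[OF S] E cancel(1) by metis
  then have *: "(\<forall>Y. T Y = (U ** P) ** Y ** (Q ** V)) \<or> (\<forall>Y. T Y = (U ** P) ** transpose Y ** (Q ** V))"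
    by (metis cancel(2) matrix_mul_assoc)
  then have "det (T (mat 1)) = det (U ** P) * det (Q ** V)"
    by (auto simp: det_mul)
  then have "det (U ** P) * det (Q ** V) = 1"
    using det_preserverD(4)[OF T] by simp
  with * show ?thesis using that by blast
qed

section \<open>The Jordan algebra as a space of complex matrices\<close>

text \<open>The inverse of \<open>map_matrix coord1\<close> on \<open>J3\<close>: the condition
  \<open>adj_C X = X\<close> says that the second coordinate matrix is the transpose of the
  first.\<close>

definition embed_J3 :: "complex mat3 \<Rightarrow> cplx_C mat3"
  where "embed_J3 Y = (\<chi> i j. iota * of_C (Y $ i $ j) + conj_C iota * of_C (Y $ j $ i))"

lemma coord1_embed_J3 [simp]: "map_matrix coord1 (embed_J3 Y) = Y"
  by (simp add: embed_J3_def vec_eq_iff)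

lemma embed_J3_in_J3: "embed_J3 Y \<in> J3"
  unfolding J3_iff by (auto intro!: coord_eqI simp: embed_J3_def)

lemma embed_J3_coord1:
  assumes "X \<in> J3"
  shows "embed_J3 (map_matrix coord1 X) = X"
proof -
  have "coord2 (X $ i $ j) = coord1 (X $ j $ i)" for i j
    using assms coord_hom(13) unfolding J3_iff by metis
  then show ?thesis
    by (auto simp: embed_J3_def vec_eq_iff intro!: coord_eqI)
qed

lemma J3_eqI: "X \<in> J3 \<Longrightarrow> Y \<in> J3 \<Longrightarrow> map_matrix coord1 X = map_matrix coord1 Y \<Longrightarrow> X = Y"
  by (metis embed_J3_coord1)

text \<open>The value lies in \<open>C\<close>, so its first coordinate determines it. There
  \<open>conj_C\<close> amounts to exchanging the two indices of an entry, which turns the formula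
  into the six terms of the ordinary determinant.\<close>

lemma coord1_J3_det:
  assumes "X \<in> J3"
  shows "J3_det X = of_C (det (map_matrix coord1 X))"
proof -
  obtain c where c: "J3_det X = of_C c" using J3_det_in_C[OF assms] by auto
  have *: "coord2 (X $ i $ j) = coord1 (X $ j $ i)" for i j
    using assms coord_hom(13) unfolding J3_iff by metis
  have "c = coord1 (J3_det X)" by (simp add: c)
  also have "\<dots> = det (map_matrix coord1 X)"
    by (simp add: J3_det_def Let_def det_3 *)
  finally show ?thesis by (simp add: c)
qed

lemma coord1_add: "map_matrix coord1 (X + Y) = map_matrix coord1 X + map_matrix coord1 Y"
  by (simp add: vec_eq_iff)

lemma coord1_scale_C: "map_matrix coord1 (scale_C c X) = map_matrix ((*) c) (map_matrix coord1 X)"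
  by (simp add: vec_eq_iff scale_C_def)

lemma J3_add: "X \<in> J3 \<Longrightarrow> Y \<in> J3 \<Longrightarrow> X + Y \<in> J3"
  by (simp add: J3_iff)

lemma J3_scale_C: "X \<in> J3 \<Longrightarrow> scale_C c X \<in> J3"
  by (simp add: J3_iff scale_C_def conj_C_of_C_mult del: conj_C_simps(2))

text \<open>The restriction to \<open>J3\<close> is there because elements of
  \<open>BijGroup J3\<close> are extensional.\<close>

definition lift_J3 :: "(complex mat3 \<Rightarrow> complex mat3) \<Rightarrow> cplx_C mat3 \<Rightarrow> cplx_C mat3"
  where "lift_J3 T = (\<lambda>X\<in>J3. embed_J3 (T (map_matrix coord1 X)))"

lemma lift_J3_mem: "X \<in> J3 \<Longrightarrow> lift_J3 T X \<in> J3"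
  by (simp add: lift_J3_def embed_J3_in_J3)

lemma coord1_lift_J3: "X \<in> J3 \<Longrightarrow> map_matrix coord1 (lift_J3 T X) = T (map_matrix coord1 X)"
  by (simp add: lift_J3_def)

lemma lift_J3_eqI: "\<alpha> \<in> extensional J3 \<Longrightarrow> (\<And>X. X \<in> J3 \<Longrightarrow> \<alpha> X \<in> J3) \<Longrightarrow>
    (\<And>X. X \<in> J3 \<Longrightarrow> map_matrix coord1 (\<alpha> X) = T (map_matrix coord1 X)) \<Longrightarrow> \<alpha> = lift_J3 T"
  by (rule extensionalityI[of _ J3])
    (auto simp: coord1_lift_J3 lift_J3_mem intro!: J3_eqI, simp add: lift_J3_def)

lemma lift_J3_inj: "lift_J3 S = lift_J3 T \<Longrightarrow> S = T"
  by (metis coord1_lift_J3 coord1_embed_J3 embed_J3_in_J3 ext)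

section \<open>Elements of \<open>E6_C\<close> as determinant preservers\<close>

lemma carrier_E6_C:
  "\<alpha> \<in> carrier E6_C \<longleftrightarrow> \<alpha> \<in> extensional J3 \<and> bij_betw \<alpha> J3 J3 \<and>
    (\<forall>X\<in>J3. \<forall>Y\<in>J3. \<alpha> (X + Y) = \<alpha> X + \<alpha> Y) \<and>
    (\<forall>c. \<forall>X\<in>J3. \<alpha> (scale_C c X) = scale_C c (\<alpha> X)) \<and> (\<forall>X\<in>J3. J3_det (\<alpha> X) = J3_det X)"
  by (auto simp: E6_C_def Iso_C_def Bij_def)

lemma mult_E6_C:
  "\<alpha> \<in> carrier E6_C \<Longrightarrow> \<beta> \<in> carrier E6_C \<Longrightarrow> \<alpha> \<otimes>\<^bsub>E6_C\<^esub> \<beta> = compose J3 \<alpha> \<beta>"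
  by (simp add: carrier_E6_C) (simp add: E6_C_def Iso_C_def BijGroup_def Bij_def)

lemma lift_J3_in_E6_C:
  assumes T: "det_preserver T"
  shows "lift_J3 T \<in> carrier E6_C"
  unfolding carrier_E6_C
proof (intro conjI ballI allI)
  show "lift_J3 T \<in> extensional J3" by (simp add: lift_J3_def)
  have T_inv: "T (inv_into UNIV T Y) = Y" "inv_into UNIV T (T Y) = Y" for Y
    using det_preserverD(1)[OF T] by (simp_all add: bij_is_surj surj_f_inv_f bij_is_inj)
  show "bij_betw (lift_J3 T) J3 J3"
    by (rule bij_betw_byWitness[of _ "lift_J3 (inv_into UNIV T)"])
      (auto simp: coord1_lift_J3 lift_J3_mem T_inv intro!: J3_eqI)
  fix X assume X: "X \<in> J3"
  show "lift_J3 T (X + Y) = lift_J3 T X + lift_J3 T Y" if "Y \<in> J3" for Y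
    by (rule J3_eqI) (simp_all add: X that lift_J3_mem J3_add coord1_lift_J3 coord1_add det_preserverD(2)[OF T])
  show "lift_J3 T (scale_C c X) = scale_C c (lift_J3 T X)" for c
    by (rule J3_eqI)
      (simp_all add: X lift_J3_mem J3_scale_C coord1_lift_J3 coord1_scale_C det_preserverD(3)[OF T])
  show "J3_det (lift_J3 T X) = J3_det X"
    by (simp add: X coord1_J3_det lift_J3_mem coord1_lift_J3 det_preserverD(4)[OF T])
qed

lemma lift_J3_mult:
  assumes "det_preserver S" "det_preserver T"
  shows "lift_J3 S \<otimes>\<^bsub>E6_C\<^esub> lift_J3 T = lift_J3 (S \<circ> T)"
  using assms
  by (auto simp: mult_E6_C lift_J3_in_E6_C compose_def coord1_lift_J3 lift_J3_mem intro!: lift_J3_eqI)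

lemma one_E6_C: "\<one>\<^bsub>E6_C\<^esub> = lift_J3 id"
  by (rule lift_J3_eqI) (auto simp: E6_C_def Iso_C_def BijGroup_def)

lemma E6_C_eq_lift_J3:
  assumes \<alpha>: "\<alpha> \<in> carrier E6_C"
  obtains T where "det_preserver T" "\<alpha> = lift_J3 T"
proof
  define T where "T Y = map_matrix coord1 (\<alpha> (embed_J3 Y))" for Y
  have bij: "bij_betw \<alpha> J3 J3" using \<alpha> by (simp add: carrier_E6_C)
  then have mem: "\<alpha> X \<in> J3" if "X \<in> J3" for X using that by (meson bij_betwE)
  have embed: "embed_J3 (X + Y) = embed_J3 X + embed_J3 Y"
    "embed_J3 (map_matrix ((*) c) X) = scale_C c (embed_J3 X)" for X Y c
    by (rule J3_eqI; simp add: embed_J3_in_J3 J3_add J3_scale_C coord1_add coord1_scale_C)+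
  show "det_preserver T"
    unfolding det_preserver_def
  proof (intro conjI allI)
    have "bij_betw embed_J3 UNIV J3"
      by (rule bij_betw_byWitness[of _ "map_matrix coord1"])
        (auto simp: embed_J3_in_J3 embed_J3_coord1)
    moreover have "bij_betw (map_matrix coord1) J3 UNIV"
      by (rule bij_betw_byWitness[of _ embed_J3]) (auto simp: embed_J3_in_J3 embed_J3_coord1)
    ultimately have "bij (map_matrix coord1 \<circ> \<alpha> \<circ> embed_J3)"
      using bij by (blast intro: bij_betw_trans)
    then show "bij T" by (simp add: T_def[abs_def] o_def)
    show "T (X + Y) = T X + T Y" for X Y
      using \<alpha> by (simp add: T_def embed carrier_E6_C embed_J3_in_J3 coord1_add)
    show "T (map_matrix ((*) c) X) = map_matrix ((*) c) (T X)" for c X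
      using \<alpha> by (simp add: T_def embed carrier_E6_C embed_J3_in_J3 coord1_scale_C)
    fix X
    have "of_C (det (T X)) = of_C (det X)"
      using \<alpha> mem[OF embed_J3_in_J3]
      by (simp add: T_def carrier_E6_C embed_J3_in_J3 flip: coord1_J3_det)
        (simp add: coord1_J3_det embed_J3_in_J3)
    then show "det (T X) = det X" by (metis coord_hom(11))
  qed
  show "\<alpha> = lift_J3 T"
    using \<alpha> by (intro lift_J3_eqI) (auto simp: carrier_E6_C mem T_def embed_J3_coord1)
qed

section \<open>The action of pairs of matrices\<close>

lemma SL3_matrix_inv_simps:
  fixes A B :: "complex mat3"
  assumes "det A = 1"
  shows "det (matrix_inv A) = 1"
    and "matrix_inv (transpose A) = transpose (matrix_inv A)"
    and "matrix_inv (matrix_inv A) = A"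
    and "det B = 1 \<Longrightarrow> matrix_inv (A ** B) = matrix_inv B ** matrix_inv A"
proof -
  note inv = SL3_matrix_inv[OF assms]
  show *: "det (matrix_inv A) = 1"
    using inv assms by (metis det_I det_mul mult_1)
  show "matrix_inv (transpose A) = transpose (matrix_inv A)"
    using assms inv
    by (intro SL3_matrix_inv_unique) (simp_all add: det_transpose transpose_mat flip: matrix_transpose_mul)
  show "matrix_inv (matrix_inv A) = A"
    using * inv by (intro SL3_matrix_inv_unique)
  assume B: "det B = 1"
  have "matrix_inv B ** matrix_inv A ** (A ** B) = mat 1"
    by (metis inv(2) SL3_matrix_inv(2)[OF B] matrix_mul_assoc matrix_mul_lid)
  then show "matrix_inv (A ** B) = matrix_inv B ** matrix_inv A"
    using assms B by (intro SL3_matrix_inv_unique) (simp_all add: det_mul)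
qed

text \<open>The inverse on \<open>B\<close> makes right multiplication a left action, so that pairs
  multiply as the maps compose.\<close>

definition pair_act :: "complex mat3 \<times> complex mat3 \<Rightarrow> complex mat3 \<Rightarrow> complex mat3"
  where "pair_act = (\<lambda>(A, B) Y. A ** Y ** matrix_inv B)"

text \<open>This is \<open>eps\<close> read through \<open>SL3_to_SU3\<close>, and also the effect
  on pairs of conjugating \<open>pair_act\<close> by the transposition.\<close>

definition SL3_flip :: "complex mat3 \<times> complex mat3 \<Rightarrow> complex mat3 \<times> complex mat3"
  where "SL3_flip = (\<lambda>(A, B). (transpose (matrix_inv B), transpose (matrix_inv A)))"

lemma carrier_SL3 [simp]: "A \<in> carrier SL3 \<longleftrightarrow> det A = 1"
  by (simp add: SL3_def)

lemma mult_SL3 [simp]: "A \<otimes>\<^bsub>SL3\<^esub> B = A ** B"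
  by (simp add: SL3_def)

lemma carrier_SL3_sq: "p \<in> carrier (SL3 \<times>\<times> SL3) \<longleftrightarrow> det (fst p) = 1 \<and> det (snd p) = 1"
  by (cases p) simp

lemma mult_SL3_sq: "p \<otimes>\<^bsub>SL3 \<times>\<times> SL3\<^esub> q = (fst p ** fst q, snd p ** snd q)"
  by (cases p; cases q) simp

lemma det_preserver_pair_act: "p \<in> carrier (SL3 \<times>\<times> SL3) \<Longrightarrow> det_preserver (pair_act p)"
  unfolding pair_act_def carrier_SL3_sq
  by (auto simp: split_def SL3_matrix_inv_simps intro!: det_preserver_mult)

lemma pair_act_hom: "(\<lambda>p. lift_J3 (pair_act p)) \<in> hom (SL3 \<times>\<times> SL3) E6_C"
proof (rule homI)
  fix p q assume pq: "p \<in> carrier (SL3 \<times>\<times> SL3)" "q \<in> carrier (SL3 \<times>\<times> SL3)"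
  then have "pair_act (p \<otimes>\<^bsub>SL3 \<times>\<times> SL3\<^esub> q) = pair_act p \<circ> pair_act q"
    by (cases p; cases q) (simp add: fun_eq_iff pair_act_def SL3_matrix_inv_simps matrix_mul_assoc)
  then show "lift_J3 (pair_act (p \<otimes>\<^bsub>SL3 \<times>\<times> SL3\<^esub> q)) =
      lift_J3 (pair_act p) \<otimes>\<^bsub>E6_C\<^esub> lift_J3 (pair_act q)"
    using pq by (simp add: lift_J3_mult det_preserver_pair_act)
qed (simp add: lift_J3_in_E6_C det_preserver_pair_act)

lemma mat_in_SL3_sq:
  fixes a :: complex
  shows "a ^ 3 = 1 \<Longrightarrow> (mat a, mat a) \<in> carrier (SL3 \<times>\<times> SL3)"
  by (simp add: carrier_SL3_sq det_3 mat_def power3_eq_cube)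

lemma Z3_iff:
  assumes "\<omega> ^ 3 = 1" "\<omega> \<noteq> 1"
  shows "p \<in> Z3 \<omega> \<longleftrightarrow> (\<exists>a. a ^ 3 = 1 \<and> p = (mat a, mat a))"
proof -
  have "a ^ 3 = 1 \<longleftrightarrow> a = 1 \<or> a = \<omega> \<or> a = \<omega>\<^sup>2" for a
  proof
    assume "a ^ 3 = 1"
    \<comment> \<open>From \<open>\<omega> \<noteq> 1\<close> follows
      \<open>1 + \<omega> + \<omega>^2 = 0\<close>, so the product is
      \<open>a^3 - 1\<close>.\<close>
    then have "(a - 1) * ((a - \<omega>) * (a - \<omega>\<^sup>2)) = 0"
      using assms by algebra
    then show "a = 1 \<or> a = \<omega> \<or> a = \<omega>\<^sup>2" by simp
  next
    assume "a = 1 \<or> a = \<omega> \<or> a = \<omega>\<^sup>2"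
    then show "a ^ 3 = 1" using assms(1) by (elim disjE) (simp, simp, algebra)
  qed
  then show ?thesis by (auto simp: Z3_def)
qed

lemma pair_act_eq_id:
  assumes p: "p \<in> carrier (SL3 \<times>\<times> SL3)"
  shows "pair_act p = id \<longleftrightarrow> (\<exists>a. a ^ 3 = 1 \<and> p = (mat a, mat a))"
proof
  assume *: "pair_act p = id"
  obtain A B where AB: "p = (A, B)" by force
  then have d: "det A = 1" "det B = 1" using p by (auto simp: carrier_SL3_sq)
  have eq: "A ** Y = Y ** B" for Y
  proof -
    have "A ** Y ** matrix_inv B = Y" using fun_cong[OF *, of Y] by (simp add: AB pair_act_def)
    then show ?thesis by (metis SL3_matrix_inv(2)[OF d(2)] matrix_mul_assoc matrix_mul_rid)
  qed
  have "(A ** munit i j) $ k $ l = (munit i j ** B) $ k $ l" for i j k l by (simp add: eq)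
  note u = this[unfolded matrix_matrix_mult_def]
  \<comment> \<open>The first six instances kill the off-diagonal entries of \<open>A\<close>; the
    last four equate its diagonal entries by way of those of \<open>B\<close>.\<close>
  have "A = mat (A $ 1 $ 1)"
    using u[of 1 1 2 1] u[of 1 1 3 1] u[of 2 2 1 2] u[of 2 2 3 2] u[of 3 3 1 3] u[of 3 3 2 3]
      u[of 1 2 1 2] u[of 1 3 1 3] u[of 2 2 2 2] u[of 3 3 3 3]
    by (simp add: vec_eq_iff forall_3 mat_def sum_3)
  moreover have "B = A" using eq[of "mat 1"] by simp
  moreover have "det (mat a :: complex mat3) = a ^ 3" for a
    by (simp add: det_3 mat_def power3_eq_cube)
  ultimately show "\<exists>a. a ^ 3 = 1 \<and> p = (mat a, mat a)"
    using d AB by metis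
next
  assume "\<exists>a. a ^ 3 = 1 \<and> p = (mat a, mat a)"
  then obtain a where a: "a ^ 3 = 1" "p = (mat a, mat a)" by blast
  then have "a * a\<^sup>2 = 1" by (simp add: power2_eq_square power3_eq_cube mult.assoc)
  have "matrix_inv (mat a :: complex mat3) = mat (a\<^sup>2)"
    using mat_in_SL3_sq[OF a(1)] \<open>a * a\<^sup>2 = 1\<close>
    by (intro SL3_matrix_inv_unique)
      (auto simp: carrier_SL3_sq vec_eq_iff matrix_matrix_mult_def mat_def sum_3 forall_3 mult.commute)
  then show "pair_act p = id"
    using \<open>a * a\<^sup>2 = 1\<close>
    by (auto simp: fun_eq_iff a(2) pair_act_def vec_eq_iff matrix_matrix_mult_def mat_def sum_3 forall_3
        algebra_simps)
qed

text \<open>Entries of the images of matrix units are products of an entry of \<open>A\<close> and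
  one of \<open>matrix_inv B\<close>. Three of them would make \<open>A $ 2 $ 1\<close> both zero
  and nonzero.\<close>

lemma transpose_not_pair_act: "pair_act p \<noteq> transpose"
proof
  assume *: "pair_act p = transpose"
  obtain A B where AB: "p = (A, B)" by force
  have "(A ** munit i j ** matrix_inv B) $ k $ l = munit j i $ k $ l" for i j k l
    using fun_cong[OF *, of "munit i j"] by (auto simp: AB pair_act_def transpose_def vec_eq_iff)
  note u = this[unfolded matrix_matrix_mult_def]
  have "A $ 1 $ 1 * matrix_inv B $ 1 $ 1 = 1" "A $ 2 $ 1 * matrix_inv B $ 1 $ 1 = 0"
    "A $ 2 $ 1 * matrix_inv B $ 2 $ 1 = 1"
    using u[of 1 1 1 1] u[of 1 1 2 1] u[of 1 2 2 1] by (simp_all add: sum_3)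
  then show False by auto
qed

lemma det_preserver_eq_pair_act:
  assumes "det_preserver T"
  obtains p where "p \<in> carrier (SL3 \<times>\<times> SL3)" "T = pair_act p \<or> T = pair_act p \<circ> transpose"
proof -
  obtain P Q where PQ: "det P * det Q = 1"
    "(\<forall>Y. T Y = P ** Y ** Q) \<or> (\<forall>Y. T Y = P ** transpose Y ** Q)"
    using frobenius_det_preserver[OF assms] by blast
  have "det P \<noteq> 0" using PQ(1) by auto
  \<comment> \<open>A cube root of \<open>det P\<close>: dividing \<open>P\<close> and multiplying
    \<open>Q\<close> by it keeps the map and makes both determinants 1.\<close>
  define c where "c = exp (Ln (det P) / 3)"
  have c3: "c ^ 3 = det P"
    using \<open>det P \<noteq> 0\<close> by (simp add: c_def flip: exp_of_nat_mult)
  have c0: "c \<noteq> 0" by (simp add: c_def)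
  define A B' where "A = mat (1 / c) ** P" and "B' = mat c ** Q"
  have dm: "det (mat a :: complex mat3) = a ^ 3" for a
    by (simp add: det_3 mat_def power3_eq_cube)
  have dA: "det A = 1" "det B' = 1"
    using c3 c0 \<open>det P \<noteq> 0\<close> PQ(1) by (simp_all add: A_def B'_def det_mul dm power_divide)
  have "P ** Y ** Q = A ** Y ** B'" for Y
  proof -
    have "A ** Y ** B' = mat (1 / c) ** (mat c ** (P ** Y ** Q))"
      by (simp add: A_def B'_def vec_eq_iff matrix_matrix_mult_def mat_def sum_3 forall_3 algebra_simps)
    also have "\<dots> = P ** Y ** Q"
      using c0 by (simp add: vec_eq_iff matrix_matrix_mult_def mat_def sum_3 forall_3)
    finally show ?thesis by simp
  qed
  then have "T = pair_act (A, matrix_inv B') \<or> T = pair_act (A, matrix_inv B') \<circ> transpose"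
    using PQ(2) dA by (auto simp: pair_act_def SL3_matrix_inv_simps fun_eq_iff)
  moreover have "(A, matrix_inv B') \<in> carrier (SL3 \<times>\<times> SL3)"
    using dA by (simp add: carrier_SL3_sq SL3_matrix_inv_simps)
  ultimately show thesis using that by blast
qed

text \<open>Transposing \<open>A ** Y ** matrix_inv B\<close> reverses the factors, and
  \<open>transpose A\<close> is the inverse of the inverse transpose of \<open>A\<close>.\<close>

lemma transpose_pair_act:
  assumes "p \<in> carrier (SL3 \<times>\<times> SL3)"
  shows "transpose \<circ> pair_act p = pair_act (SL3_flip p) \<circ> transpose"
  using assms
  by (auto simp: fun_eq_iff carrier_SL3_sq pair_act_def SL3_flip_def split_def
      SL3_matrix_inv_simps matrix_transpose_mul matrix_mul_assoc transpose_transpose det_transpose)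

lemma SL3_flip_flip:
  "p \<in> carrier (SL3 \<times>\<times> SL3) \<Longrightarrow> SL3_flip (SL3_flip p) = p"
  by (cases p) (simp add: carrier_SL3_sq SL3_flip_def SL3_matrix_inv_simps transpose_transpose det_transpose)

lemma SL3_flip_hom: "SL3_flip \<in> hom (SL3 \<times>\<times> SL3) (SL3 \<times>\<times> SL3)"
  by (rule homI)
    (auto simp: mult_SL3_sq carrier_SL3_sq SL3_flip_def split_def SL3_matrix_inv_simps
      matrix_transpose_mul det_transpose)

text \<open>Conjugating the trivial map by the transposition leaves it trivial, so the flip
  preserves the kernel of the action, which is \<open>Z3 \<omega>\<close>.\<close>

lemma SL3_flip_Z3:
  assumes "\<omega> ^ 3 = 1" "\<omega> \<noteq> 1" "p \<in> Z3 \<omega>"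
  shows "SL3_flip p \<in> Z3 \<omega>"
proof -
  have p: "p \<in> carrier (SL3 \<times>\<times> SL3)" "pair_act p = id"
    using assms(3) mat_in_SL3_sq pair_act_eq_id unfolding Z3_iff[OF assms(1,2)] by blast+
  then have "pair_act (SL3_flip p) \<circ> transpose = id \<circ> transpose"
    using transpose_pair_act[OF p(1)] by simp
  then have "pair_act (SL3_flip p) = id"
    by (metis comp_assoc comp_id transpose_transpose comp_apply ext id_apply)
  then show ?thesis
    using pair_act_eq_id hom_in_carrier[OF SL3_flip_hom p(1)] unfolding Z3_iff[OF assms(1,2)] by blast
qed

text \<open>\<open>SL3_to_SU3 A\<close> has coordinate matrices \<open>A\<close> and the inverse
  transpose of \<open>A\<close>, and \<open>conj_C\<close> swaps the two coordinates.\<close>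

lemma map_matrix_conj_C_SL3_to_SU3:
  assumes "det A = 1"
  shows "map_matrix conj_C (SL3_to_SU3 A) = SL3_to_SU3 (transpose (matrix_inv A))"
proof (rule map_matrix_coord_eqI)
  have swap: "map_matrix coord1 (map_matrix conj_C X) = map_matrix coord2 X"
    "map_matrix coord2 (map_matrix conj_C X) = map_matrix coord1 X" for X :: "cplx_C mat3"
    by (simp_all add: vec_eq_iff)
  show "map_matrix coord1 (map_matrix conj_C (SL3_to_SU3 A)) =
      map_matrix coord1 (SL3_to_SU3 (transpose (matrix_inv A)))"
    by (simp add: swap map_matrix_coord_SL3_to_SU3)
  show "map_matrix coord2 (map_matrix conj_C (SL3_to_SU3 A)) =
      map_matrix coord2 (SL3_to_SU3 (transpose (matrix_inv A)))"
    using assms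
    by (simp add: swap map_matrix_coord_SL3_to_SU3 SL3_matrix_inv_simps transpose_transpose)
qed

lemma eps_SL3_to_SU3:
  assumes "p \<in> carrier (SL3 \<times>\<times> SL3)"
  shows "eps (map_prod SL3_to_SU3 SL3_to_SU3 p) = map_prod SL3_to_SU3 SL3_to_SU3 (SL3_flip p)"
  using assms by (cases p) (simp add: carrier_SL3_sq eps_def SL3_flip_def map_matrix_conj_C_SL3_to_SU3)

section \<open>The action of \<open>Z2\<close> on cosets\<close>

lemma inj_SL3_to_SU3_sq: "inj (map_prod SL3_to_SU3 SL3_to_SU3)"
  by (intro prod.inj_map injI) (metis map_matrix_coord_SL3_to_SU3(1))+

lemma Z2_act_extensional: "Z2_act \<omega> h \<in> extensional (carrier (SL3_sq_mod_Z3 \<omega>))"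
  by (simp add: Z2_act_def)

lemma Z2_act_id:
  assumes "S \<in> carrier (SL3_sq_mod_Z3 \<omega>)" "S \<subseteq> carrier (SL3 \<times>\<times> SL3)"
  shows "Z2_act \<omega> id S = S"
  using assms by (auto simp: Z2_act_def inj_image_mem_iff[OF inj_SL3_to_SU3_sq] simp del: carrier_DirProd)

text \<open>As the identification is injective, the preimage in the definition of
  \<open>Z2_act\<close> becomes a direct image under \<open>SL3_flip\<close>.\<close>

lemma Z2_act_eps:
  assumes "S \<in> carrier (SL3_sq_mod_Z3 \<omega>)" "S \<subseteq> carrier (SL3 \<times>\<times> SL3)"
  shows "Z2_act \<omega> eps S = SL3_flip ` S"
proof -
  have "eps ` map_prod SL3_to_SU3 SL3_to_SU3 ` S = map_prod SL3_to_SU3 SL3_to_SU3 ` SL3_flip ` S"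
    unfolding image_image using assms(2) by (intro image_cong refl eps_SL3_to_SU3) blast
  then have "Z2_act \<omega> eps S = {p \<in> carrier (SL3 \<times>\<times> SL3). p \<in> SL3_flip ` S}"
    using assms(1) by (simp add: Z2_act_def inj_image_mem_iff[OF inj_SL3_to_SU3_sq] del: carrier_DirProd)
  then show ?thesis
    using assms(2) hom_in_carrier[OF SL3_flip_hom] by blast
qed

lemma eps_neq_id: "eps \<noteq> id"
proof
  assume "eps = id"
  then have "snd (eps (mat 1, 0)) $ 1 $ 1 = 0" by simp
  then show False by (simp add: eps_def mat_def)
qed

lemma eps_eps: "eps \<circ> eps = id"
  by (auto simp: eps_def fun_eq_iff vec_eq_iff)

section \<open>The semidirect product\<close>

lemma (in normal) image_rcos_automorphism:
  assumes \<sigma>: "\<sigma> \<in> hom G G" and H: "\<sigma> ` H = H" and x: "x \<in> carrier G"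
  shows "\<sigma> ` (H #> x) = H #> \<sigma> x"
proof -
  have "\<sigma> ` (H #> x) = (\<lambda>h. \<sigma> h \<otimes> \<sigma> x) ` H"
  proof -
    have "\<sigma> (h \<otimes> x) = \<sigma> h \<otimes> \<sigma> x" if "h \<in> H" for h
      using that x subset hom_mult[OF \<sigma>] by blast
    then show ?thesis by (simp add: r_coset_def image_UN image_image UNION_singleton_eq_range)
  qed
  also have "\<dots> = (\<lambda>h. h \<otimes> \<sigma> x) ` \<sigma> ` H" by (simp add: image_image)
  also have "\<dots> = H #> \<sigma> x" by (auto simp: H r_coset_def)
  finally show ?thesis .
qed

text \<open>Since \<sigma> is an involution, its action on cosets is its own inverse, which gives
  bijectivity; products are checked on representatives.\<close>

lemma (in normal) image_auto_FactGroup: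
  assumes \<sigma>: "\<sigma> \<in> hom G G" and inv: "\<And>x. x \<in> carrier G \<Longrightarrow> \<sigma> (\<sigma> x) = x" and H: "\<sigma> ` H = H"
  shows "(\<lambda>S\<in>carrier (G Mod H). \<sigma> ` S) \<in> auto (G Mod H)"
proof -
  note img = image_rcos_automorphism[OF \<sigma> H]
  note mem = hom_in_carrier[OF \<sigma>]
  have bij: "bij_betw ((`) \<sigma>) (carrier (G Mod H)) (carrier (G Mod H))"
    by (rule bij_betw_byWitness[of _ "(`) \<sigma>"]) (auto simp: carrier_FactGroup img mem inv)
  have "(`) \<sigma> \<in> hom (G Mod H) (G Mod H)"
  proof (rule homI)
    show "\<sigma> ` S \<in> carrier (G Mod H)" if "S \<in> carrier (G Mod H)" for S
      using bij that by (meson bij_betwE)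
    fix S T assume "S \<in> carrier (G Mod H)" "T \<in> carrier (G Mod H)"
    then obtain x y where "x \<in> carrier G" "y \<in> carrier G" "S = H #> x" "T = H #> y"
      by (auto simp: carrier_FactGroup)
    then show "\<sigma> ` (S \<otimes>\<^bsub>G Mod H\<^esub> T) = \<sigma> ` S \<otimes>\<^bsub>G Mod H\<^esub> \<sigma> ` T"
      by (simp add: img mem rcos_sum hom_mult[OF \<sigma>])
  qed
  then have "(\<lambda>S\<in>carrier (G Mod H). \<sigma> ` S) \<in> hom (G Mod H) (G Mod H)"
    using group.is_monoid[OF factorgroup_is_group]
    by (auto simp: hom_def monoid.m_closed simp del: mult_FactGroup)
  then show ?thesis
    using bij by (auto simp: auto_def Bij_def)
qed

text \<open>Closure places products of preimages where \<open>h\<close> is injective, so the inverse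
  map is multiplicative. It serves to reverse the isomorphism from the semidirect product.\<close>

lemma iso_sym_of_closed:
  assumes "h \<in> iso G H" "\<And>x y. x \<in> carrier G \<Longrightarrow> y \<in> carrier G \<Longrightarrow> x \<otimes>\<^bsub>G\<^esub> y \<in> carrier G"
  shows "H \<cong> G"
proof -
  have hom: "h \<in> hom G H" and bij: "bij_betw h (carrier G) (carrier H)"
    using assms(1) by (auto simp: iso_def)
  let ?g = "inv_into (carrier G) h"
  have g: "?g y \<in> carrier G" "h (?g y) = y" if "y \<in> carrier H" for y
    using that bij by (auto simp: bij_betw_def inv_into_into f_inv_into_f)
  have "?g (x \<otimes>\<^bsub>H\<^esub> y) = ?g x \<otimes>\<^bsub>G\<^esub> ?g y" if "x \<in> carrier H" "y \<in> carrier H" for x y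
    using that bij by (intro inv_into_f_eq) (auto simp: bij_betw_def g assms(2) hom_mult[OF hom])
  then have "?g \<in> iso H G"
    using g bij_betw_inv_into[OF bij] by (auto simp: iso_def hom_def)
  then show ?thesis by (auto simp: is_iso_def)
qed

theorem theorem4p1p7:
  fixes \<omega> :: complex
  assumes "\<omega> ^ 3 = 1" and "\<omega> \<noteq> 1"
  shows "Z2_act \<omega> \<in> hom Z2 (AutoGroup (SL3_sq_mod_Z3 \<omega>)) \<and>
         E6_C \<cong> semidirect (SL3_sq_mod_Z3 \<omega>) Z2 (Z2_act \<omega>)"
proof
  let ?G = "SL3 \<times>\<times> SL3" and ?Q = "SL3_sq_mod_Z3 \<omega>"
  interpret N: normal "Z3 \<omega>" ?G by (rule Z3_normal[OF assms(1)])
  interpret Q: group ?Q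
    unfolding SL3_sq_mod_Z3_def by (rule N.factorgroup_is_group)
  interpret E: group E6_C by (rule group_E6_C)
  interpret act: group_hom ?G E6_C "\<lambda>p. lift_J3 (pair_act p)"
    by unfold_locales (rule pair_act_hom)
  have flip_Z3: "SL3_flip ` Z3 \<omega> = Z3 \<omega>"
    using SL3_flip_Z3[OF assms] SL3_flip_flip N.subset by (force simp del: carrier_DirProd)
  have coset: "\<exists>p\<in>carrier ?G. S = Z3 \<omega> #>\<^bsub>?G\<^esub> p" if "S \<in> carrier ?Q" for S
    using that by (auto simp: SL3_sq_mod_Z3_def carrier_FactGroup simp del: carrier_DirProd)
  have coset_sub: "S \<subseteq> carrier ?G" if "S \<in> carrier ?Q" for S
    using coset[OF that] N.r_coset_subset_G[OF N.subset] by blast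
  have Z2_id: "Z2_act \<omega> id = (\<lambda>S\<in>carrier ?Q. S)"
    by (rule extensionalityI[OF Z2_act_extensional restrict_extensional])
      (simp add: Z2_act_id coset_sub del: carrier_DirProd)
  have Z2_eps: "Z2_act \<omega> eps = (\<lambda>S\<in>carrier ?Q. SL3_flip ` S)"
    by (rule extensionalityI[OF Z2_act_extensional restrict_extensional])
      (simp add: Z2_act_eps coset_sub del: carrier_DirProd)
  have auto_id: "Z2_act \<omega> id \<in> auto ?Q" by (simp add: Z2_id Q.id_in_auto)
  have auto_eps: "Z2_act \<omega> eps \<in> auto ?Q"
    unfolding Z2_eps SL3_sq_mod_Z3_def
    by (rule N.image_auto_FactGroup[OF SL3_flip_hom SL3_flip_flip flip_Z3])
  have Z2_cases: "h = id \<or> h = eps" if "h \<in> carrier Z2" for h using that by (auto simp: Z2_def)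
  have act_mem: "Z2_act \<omega> h S \<in> carrier ?Q" if "h \<in> carrier Z2" "S \<in> carrier ?Q" for h S
  proof -
    have "Z2_act \<omega> h \<in> hom ?Q ?Q"
      using Z2_cases[OF that(1)] auto_id auto_eps by (auto simp: auto_def)
    then show ?thesis using that(2) by (rule hom_in_carrier)
  qed
  have Z2_eps_eps: "Z2_act \<omega> eps (Z2_act \<omega> eps S) = S" if S: "S \<in> carrier ?Q" for S
  proof -
    have "SL3_flip ` S \<in> carrier ?Q"
      using act_mem[of eps S] S by (simp add: Z2_def Z2_eps)
    moreover have "SL3_flip ` SL3_flip ` S = S"
    proof -
      have "SL3_flip (SL3_flip p) = p" if "p \<in> S" for p
        using coset_sub[OF S] that by (intro SL3_flip_flip) blast
      then show ?thesis by (simp add: image_image)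
    qed
    ultimately show ?thesis using S by (simp add: Z2_eps)
  qed

  \<comment> \<open>\<open>Z2\<close> acts by automorphisms of the quotient\<close>
  show "Z2_act \<omega> \<in> hom Z2 (AutoGroup ?Q)"
  proof (rule homI)
    fix h h' assume "h \<in> carrier Z2" "h' \<in> carrier Z2"
    then have h: "h = id \<or> h = eps" "h' = id \<or> h' = eps" by (auto simp: Z2_def)
    have B: "Z2_act \<omega> id \<in> Bij (carrier ?Q)" "Z2_act \<omega> eps \<in> Bij (carrier ?Q)"
      using auto_id auto_eps by (auto simp: auto_def)
    have "compose (carrier ?Q) (Z2_act \<omega> eps) (Z2_act \<omega> eps) = (\<lambda>S\<in>carrier ?Q. S)"
      unfolding compose_def by (rule restrict_ext) (rule Z2_eps_eps)
    then have "compose (carrier ?Q) (Z2_act \<omega> h) (Z2_act \<omega> h') = Z2_act \<omega> (h \<circ> h')"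
      using h B[THEN Bij_imp_funcset] B[THEN Bij_imp_extensional]
      by (elim disjE) (simp_all add: Z2_id eps_eps del: restrict_apply)
    moreover have "Z2_act \<omega> h \<in> Bij (carrier ?Q)" "Z2_act \<omega> h' \<in> Bij (carrier ?Q)"
      using h B by auto
    ultimately show "Z2_act \<omega> (h \<otimes>\<^bsub>Z2\<^esub> h') = Z2_act \<omega> h \<otimes>\<^bsub>AutoGroup ?Q\<^esub> Z2_act \<omega> h'"
      by (simp add: Z2_def AutoGroup_def BijGroup_def)
  qed (use auto_id auto_eps in \<open>auto simp: Z2_def AutoGroup_def\<close>)

  \<comment> \<open>The embedded quotient and the involution given by transposition\<close>
  define t where "t = lift_J3 transpose"
  have t: "t \<in> carrier E6_C" by (simp add: t_def lift_J3_in_E6_C det_preserver_transpose)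
  have "transpose \<circ> transpose = (id :: complex mat3 \<Rightarrow> _)"
    by (simp add: fun_eq_iff transpose_transpose)
  then have tt: "t \<otimes>\<^bsub>E6_C\<^esub> t = \<one>\<^bsub>E6_C\<^esub>"
    by (simp add: t_def lift_J3_mult det_preserver_transpose one_E6_C)
  have ker: "lift_J3 (pair_act p) = \<one>\<^bsub>E6_C\<^esub> \<longleftrightarrow> p \<in> Z3 \<omega>" if "p \<in> carrier ?G" for p
  proof -
    have "lift_J3 (pair_act p) = \<one>\<^bsub>E6_C\<^esub> \<longleftrightarrow> pair_act p = id"
      using lift_J3_inj[of "pair_act p" id] by (auto simp: one_E6_C)
    then show ?thesis by (simp only: pair_act_eq_id[OF that] Z3_iff[OF assms])
  qed
  have Z3_kernel: "Z3 \<omega> \<subseteq> kernel ?G E6_C (\<lambda>p. lift_J3 (pair_act p))"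
  proof
    fix p assume "p \<in> Z3 \<omega>"
    then show "p \<in> kernel ?G E6_C (\<lambda>p. lift_J3 (pair_act p))"
      using ker[OF N.mem_carrier] by (simp add: kernel_def N.mem_carrier del: carrier_DirProd)
  qed
  \<comment> \<open>The action on the Jordan algebra factors through the quotient because
    \<open>Z3 \<omega>\<close> acts trivially.\<close>
  obtain F where F: "F \<in> hom ?Q E6_C"
    and F_coset: "\<And>p. p \<in> carrier ?G \<Longrightarrow> F (Z3 \<omega> #>\<^bsub>?G\<^esub> p) = lift_J3 (pair_act p)"
    by (rule act.FactGroup_universal_kernel[OF Z3_normal[OF assms(1)] Z3_kernel,
        folded SL3_sq_mod_Z3_def]) (rule that)
  interpret F: group_hom ?Q E6_C F by unfold_locales (rule F)
  have F_one: "S = \<one>\<^bsub>?Q\<^esub>" if S: "S \<in> carrier ?Q" and "F S = \<one>\<^bsub>E6_C\<^esub>" for S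
  proof -
    obtain p where p: "p \<in> carrier ?G" "S = Z3 \<omega> #>\<^bsub>?G\<^esub> p" using coset[OF S] by blast
    then have "p \<in> Z3 \<omega>" using that(2) ker[OF p(1)] F_coset[OF p(1)] by simp
    then show ?thesis
      using p(2) N.rcos_const[of p] by (simp add: SL3_sq_mod_Z3_def)
  qed
  have F_neq: "F S \<noteq> t" if S: "S \<in> carrier ?Q" for S
  proof -
    obtain p where "p \<in> carrier ?G" "S = Z3 \<omega> #>\<^bsub>?G\<^esub> p" using coset[OF S] by blast
    then show ?thesis
      using F_coset[of p] transpose_not_pair_act[of p] lift_J3_inj[of "pair_act p" transpose]
      by (auto simp: t_def)
  qed
  \<comment> \<open>Conjugation by \<open>t\<close> realises the action of \<open>eps\<close>: this
    is \<open>transpose_pair_act\<close> on a representative.\<close>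
  have t_F: "t \<otimes>\<^bsub>E6_C\<^esub> F S = F (Z2_act \<omega> eps S) \<otimes>\<^bsub>E6_C\<^esub> t" if S: "S \<in> carrier ?Q" for S
  proof -
    obtain p where p: "p \<in> carrier ?G" "S = Z3 \<omega> #>\<^bsub>?G\<^esub> p" using coset[OF S] by blast
    have fp: "SL3_flip p \<in> carrier ?G" using hom_in_carrier[OF SL3_flip_hom p(1)] .
    have "Z2_act \<omega> eps S = Z3 \<omega> #>\<^bsub>?G\<^esub> SL3_flip p"
      using S N.image_rcos_automorphism[OF SL3_flip_hom flip_Z3 p(1)] by (simp add: Z2_eps p(2))
    then show ?thesis
      using p fp transpose_pair_act[OF p(1)]
      by (simp add: F_coset t_def lift_J3_mult det_preserver_transpose det_preserver_pair_act
          del: carrier_DirProd)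
  qed
  \<comment> \<open>This copies \<open>Z2\<close> onto the subgroup generated by \<open>t\<close>;
    on the carrier of \<open>Z2\<close> the default branch means \<open>eps\<close>.\<close>
  define \<tau> where "\<tau> h = (if h = id then \<one>\<^bsub>E6_C\<^esub> else t)"
    for h :: "cplx_C mat3 \<times> cplx_C mat3 \<Rightarrow> cplx_C mat3 \<times> cplx_C mat3"
  have \<tau>: "\<tau> h \<in> carrier E6_C" for h by (simp add: \<tau>_def t)
  have \<tau>_mult: "\<tau> (h \<otimes>\<^bsub>Z2\<^esub> h') = \<tau> h \<otimes>\<^bsub>E6_C\<^esub> \<tau> h'"
    if "h \<in> carrier Z2" "h' \<in> carrier Z2" for h h'
    using Z2_cases[OF that(1)] Z2_cases[OF that(2)]
    by (elim disjE) (simp_all add: \<tau>_def Z2_def eps_neq_id eps_eps t tt)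
  have \<tau>_F: "\<tau> h \<otimes>\<^bsub>E6_C\<^esub> F S = F (Z2_act \<omega> h S) \<otimes>\<^bsub>E6_C\<^esub> \<tau> h"
    if "h \<in> carrier Z2" "S \<in> carrier ?Q" for h S
    using Z2_cases[OF that(1)] that(2) t_F eps_neq_id by (auto simp: \<tau>_def Z2_id)

  \<comment> \<open>The isomorphism from the semidirect product\<close>
  let ?D = "semidirect ?Q Z2 (Z2_act \<omega>)"
  let ?\<Phi> = "\<lambda>(S, h). F S \<otimes>\<^bsub>E6_C\<^esub> \<tau> h"
  have hom: "?\<Phi> \<in> hom ?D E6_C"
  proof (rule homI)
    show "?\<Phi> x \<in> carrier E6_C" if "x \<in> carrier ?D" for x
      using that \<tau> by (auto simp: semidirect_def)
    fix x y assume "x \<in> carrier ?D" "y \<in> carrier ?D"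
    then obtain S h S' h' where xy: "x = (S, h)" "y = (S', h')"
      and S: "S \<in> carrier ?Q" "S' \<in> carrier ?Q" and h: "h \<in> carrier Z2" "h' \<in> carrier Z2"
      by (auto simp: semidirect_def)
    have "?\<Phi> (x \<otimes>\<^bsub>?D\<^esub> y) =
        F S \<otimes>\<^bsub>E6_C\<^esub> (F (Z2_act \<omega> h S') \<otimes>\<^bsub>E6_C\<^esub> \<tau> h) \<otimes>\<^bsub>E6_C\<^esub> \<tau> h'"
      using S h \<tau> act_mem by (simp add: xy semidirect_def \<tau>_mult E.m_assoc)
    also have "\<dots> = ?\<Phi> x \<otimes>\<^bsub>E6_C\<^esub> ?\<Phi> y"
      using S h \<tau> by (simp add: xy E.m_assoc flip: \<tau>_F)
    finally show "?\<Phi> (x \<otimes>\<^bsub>?D\<^esub> y) = ?\<Phi> x \<otimes>\<^bsub>E6_C\<^esub> ?\<Phi> y" .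
  qed
  have inj: "inj_on ?\<Phi> (carrier ?D)"
  proof (rule inj_onI)
    fix x y assume "x \<in> carrier ?D" "y \<in> carrier ?D" and eq: "?\<Phi> x = ?\<Phi> y"
    then obtain S h S' h' where xy: "x = (S, h)" "y = (S', h')"
      and S: "S \<in> carrier ?Q" "S' \<in> carrier ?Q" and h: "h \<in> carrier Z2" "h' \<in> carrier Z2"
      by (auto simp: semidirect_def)
    \<comment> \<open>Such a \<open>g\<close> lies in the image of \<open>F\<close>. For
      \<open>g = t\<close> this contradicts \<open>F_neq\<close> and forces \<open>h = h'\<close>;
      for the identity, \<open>F_one\<close> gives \<open>S = S'\<close>.\<close>
    have inv_F: "F (inv\<^bsub>?Q\<^esub> A \<otimes>\<^bsub>?Q\<^esub> B) = g"
      if "A \<in> carrier ?Q" "B \<in> carrier ?Q" "g \<in> carrier E6_C" "F A \<otimes>\<^bsub>E6_C\<^esub> g = F B" for A B g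
      using that E.inv_solve_left'[of g "F A" "F B"] by simp
    have "h = h'"
    proof (rule ccontr)
      assume "h \<noteq> h'"
      then have "h = id \<and> h' = eps \<or> h = eps \<and> h' = id" using Z2_cases h by blast
      then have "F S' \<otimes>\<^bsub>E6_C\<^esub> t = F S \<or> F S \<otimes>\<^bsub>E6_C\<^esub> t = F S'"
        using eq S eps_neq_id by (auto simp: xy \<tau>_def)
      then have "F (inv\<^bsub>?Q\<^esub> S' \<otimes>\<^bsub>?Q\<^esub> S) = t \<or> F (inv\<^bsub>?Q\<^esub> S \<otimes>\<^bsub>?Q\<^esub> S') = t"
        using inv_F S t by blast
      then show False using F_neq S by (auto simp del: F.hom_mult)
    qed
    then have "F S = F S'" using eq S \<tau> by (simp add: xy)
    then have "F (inv\<^bsub>?Q\<^esub> S \<otimes>\<^bsub>?Q\<^esub> S') = \<one>\<^bsub>E6_C\<^esub>" using inv_F S by simp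
    then have "inv\<^bsub>?Q\<^esub> S \<otimes>\<^bsub>?Q\<^esub> S' = \<one>\<^bsub>?Q\<^esub>" using F_one S by simp
    moreover have "S' = S \<otimes>\<^bsub>?Q\<^esub> (inv\<^bsub>?Q\<^esub> S \<otimes>\<^bsub>?Q\<^esub> S')" using S by (simp flip: Q.m_assoc)
    ultimately have "S = S'" using S by simp
    then show "x = y" by (simp add: xy \<open>h = h'\<close>)
  qed
  have surj: "\<alpha> \<in> ?\<Phi> ` carrier ?D" if "\<alpha> \<in> carrier E6_C" for \<alpha>
  proof -
    obtain T where T: "det_preserver T" "\<alpha> = lift_J3 T" using E6_C_eq_lift_J3[OF \<open>\<alpha> \<in> _\<close>] .
    obtain p where p: "p \<in> carrier ?G" "T = pair_act p \<or> T = pair_act p \<circ> transpose"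
      using det_preserver_eq_pair_act[OF T(1)] .
    let ?S = "Z3 \<omega> #>\<^bsub>?G\<^esub> p"
    have S: "?S \<in> carrier ?Q" using p(1) by (auto simp: SL3_sq_mod_Z3_def carrier_FactGroup simp del: carrier_DirProd)
    have "\<alpha> = F ?S \<otimes>\<^bsub>E6_C\<^esub> \<one>\<^bsub>E6_C\<^esub> \<or> \<alpha> = F ?S \<otimes>\<^bsub>E6_C\<^esub> t"
      using p T(2) S lift_J3_mult[OF det_preserver_pair_act[OF p(1)] det_preserver_transpose]
      by (auto simp: t_def F_coset simp del: carrier_DirProd)
    then have "\<alpha> = ?\<Phi> (?S, id) \<or> \<alpha> = ?\<Phi> (?S, eps)" using eps_neq_id by (auto simp: \<tau>_def)
    moreover have "(?S, id) \<in> carrier ?D" "(?S, eps) \<in> carrier ?D"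
      using S by (auto simp: semidirect_def Z2_def)
    ultimately show ?thesis by blast
  qed
  have "?\<Phi> ` carrier ?D = carrier E6_C"
    using hom_carrier[OF hom] surj by blast
  then have "?\<Phi> \<in> iso ?D E6_C"
    using hom inj by (simp add: iso_def bij_betw_def)
  moreover have "x \<otimes>\<^bsub>?D\<^esub> y \<in> carrier ?D" if "x \<in> carrier ?D" "y \<in> carrier ?D" for x y
    using that act_mem eps_eps by (auto simp: semidirect_def) (auto simp: Z2_def)
  ultimately show "E6_C \<cong> ?D" by (rule iso_sym_of_closed)
qed

end
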